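(* Let $G$ be a finite group and let $\mathcal{O}$ be a $G$-transfer system. For $H\to G$ in $\mathcal{O}$, we have a decomposition in $\underline{A}^{\mathcal{O}}_{\mathbb{Q}}(G/G)$ $$e_{[H]^{\mathcal{O}}}=\sum_{K\to H}\frac{|K|}{|N_GH|}\,\mu^{\mathcal{O}}(K,H)\,G/K,$$ where the sum is over all subgroups $K$ with $K\to H$ in $\mathcal{O}$.
   Context: A $G$-transfer system $\mathcal{O}$ is a partial order on the set $\mathrm{Sub}(G)$ of subgroups of $G$, written $K\to H$, which refines inclusion and satisfies: $K\to H$ implies $gKg^{-1}\to gHg^{-1}$ for all $g\in G$; and $K\to H$, $L\subseteq H$ imply $K\cap L\to L$. $\mathrm{Sub}^{\mathcal{O}}(G)$ is the set of subgroups $H$ with $H\to G$ in $\mathcal{O}$. $\underline{A}^{\mathcal{O}}_{\mathbb{Q}}(G/G)$ is the rationalization of the Grothendieck ring of finite $G$-sets all of whose orbits are isomorphic to some $G/K$ with $K\to G$ in $\mathcal{O}$; it has a $\mathbb{Q}$-basis given by the isomorphism classes of such orbits. $e_{[H]^{\mathcal{O}}}$ is the idempotent corresponding to the characteristic function of the conjugacy class of $H$ under the ring isomorphism from $\underline{A}^{\mathcal{O}}_{\mathbb{Q}}(G/G)$ to the ring of conjugation-invariant functions $\mathrm{Sub}^{\mathcal{O}}(G)\to\mathbb{Q}$ induced by $T\mapsto(K\mapsto|T^K|)$. For $K\to H$ in $\mathcal{O}$, the Möbius function is $\mu^{\mathcal{O}}(K,H)=\sum_i(-1)^ic_i$, where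 $c_i$ is the number of strictly increasing chains of subgroups in $\mathcal{O}$, $K=H_0\to H_1\to\cdots\to H_i=H$, and $\mu^{\mathcal{O}}(K,K)=1$. $N_GH$ is the normalizer of $H$ in $G$. *)

theory Defs
  imports Complex_Main "HOL-Algebra.Group_Action" "HOL-Algebra.Left_Coset" "HOL-Algebra.Module"
begin

section \<open>Transfer systems\<close>

definition conj_subgroup :: "('a, 'm) monoid_scheme \<Rightarrow> 'a \<Rightarrow> 'a set \<Rightarrow> 'a set" where
  "conj_subgroup G g K = g <#\<^bsub>G\<^esub> K #>\<^bsub>G\<^esub> inv\<^bsub>G\<^esub> g"

definition transfer_system ::
    "('a, 'm) monoid_scheme \<Rightarrow> ('a set \<times> 'a set) set \<Rightarrow> bool" where
  "transfer_system G \<O> \<longleftrightarrow>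
     partial_order_on {H. subgroup H G} \<O> \<and>
     (\<forall>K H. (K, H) \<in> \<O> \<longrightarrow> K \<subseteq> H) \<and>
     (\<forall>K H. \<forall>g\<in>carrier G. (K, H) \<in> \<O> \<longrightarrow> (conj_subgroup G g K, conj_subgroup G g H) \<in> \<O>) \<and>
     (\<forall>K H L. (K, H) \<in> \<O> \<and> subgroup L G \<and> L \<subseteq> H \<longrightarrow> (K \<inter> L, L) \<in> \<O>)"

definition admissible_subgroups ::
    "('a, 'm) monoid_scheme \<Rightarrow> ('a set \<times> 'a set) set \<Rightarrow> 'a set set" where
  "admissible_subgroups G \<O> = {H. (H, carrier G) \<in> \<O>}"

definition transfer_chains ::
    "('a set \<times> 'a set) set \<Rightarrow> nat \<Rightarrow> 'a set \<Rightarrow> 'a set \<Rightarrow> 'a set list set" where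
  "transfer_chains \<O> i K H =
     {Hs. length Hs = Suc i \<and> Hs ! 0 = K \<and> Hs ! i = H \<and>
          (\<forall>j<i. (Hs ! j, Hs ! Suc j) \<in> \<O> \<and> Hs ! j \<subset> Hs ! Suc j)}"

text \<open>The sum is over the lengths that occur. For a finite group these are finite in number.
  For \<open>K = H\<close> the only chain is the trivial one, so the value is 1.\<close>

definition transfer_mobius :: "('a set \<times> 'a set) set \<Rightarrow> 'a set \<Rightarrow> 'a set \<Rightarrow> int" where
  "transfer_mobius \<O> K H =
     (\<Sum>i | transfer_chains \<O> i K H \<noteq> {}. (- 1) ^ i * int (card (transfer_chains \<O> i K H)))"


section \<open>Finite G-sets\<close>

type_synonym ('a, 'b) gset = "'b set \<times> ('a \<Rightarrow> 'b \<Rightarrow> 'b)"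

definition finite_gset :: "('a, 'm) monoid_scheme \<Rightarrow> ('a, 'b) gset \<Rightarrow> bool" where
  "finite_gset G X \<longleftrightarrow> group_action G (fst X) (snd X) \<and> finite (fst X)"

definition gset_iso :: "('a, 'm) monoid_scheme \<Rightarrow> ('a, 'b) gset \<Rightarrow> ('a, 'c) gset \<Rightarrow> bool" where
  "gset_iso G X Y \<longleftrightarrow>
     (\<exists>f. bij_betw f (fst X) (fst Y) \<and>
          (\<forall>g\<in>carrier G. \<forall>x\<in>fst X. f (snd X g x) = snd Y g (f x)))"

definition gset_empty :: "('a, unit) gset" where
  "gset_empty = ({}, \<lambda>g. \<lambda>x\<in>{}. x)"

definition gset_point :: "('a, unit) gset" where
  "gset_point = ({()}, \<lambda>g. \<lambda>x\<in>{()}. x)"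

definition gset_sum :: "('a, 'b) gset \<Rightarrow> ('a, 'c) gset \<Rightarrow> ('a, 'b + 'c) gset" where
  "gset_sum X Y =
     (Sum_Type.Plus (fst X) (fst Y), \<lambda>g. restrict (map_sum (snd X g) (snd Y g)) (Sum_Type.Plus (fst X) (fst Y)))"

definition gset_prod :: "('a, 'b) gset \<Rightarrow> ('a, 'c) gset \<Rightarrow> ('a, 'b \<times> 'c) gset" where
  "gset_prod X Y =
     (fst X \<times> fst Y, \<lambda>g. restrict (map_prod (snd X g) (snd Y g)) (fst X \<times> fst Y))"

definition coset_gset :: "('a, 'm) monoid_scheme \<Rightarrow> 'a set \<Rightarrow> ('a, 'a set) gset" where
  "coset_gset G K = (lcosets\<^bsub>G\<^esub> K, \<lambda>g. \<lambda>C\<in>lcosets\<^bsub>G\<^esub> K. g <#\<^bsub>G\<^esub> C)"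

definition fixed_points :: "('a, 'b) gset \<Rightarrow> 'a set \<Rightarrow> 'b set" where
  "fixed_points X K = {x \<in> fst X. \<forall>g\<in>K. snd X g x = x}"

definition admissible_gset ::
    "('a, 'm) monoid_scheme \<Rightarrow> ('a set \<times> 'a set) set \<Rightarrow> ('a, 'b) gset \<Rightarrow> bool" where
  "admissible_gset G \<O> X \<longleftrightarrow>
     (\<forall>B \<in> orbits G (fst X) (snd X). \<exists>K \<in> admissible_subgroups G \<O>.
        gset_iso G (B, \<lambda>g. restrict (snd X g) B) (coset_gset G K))"

text \<open>Isomorphism classes are taken among the G-sets carried by sets of natural numbers;
  every finite G-set, over whatever type, is isomorphic to one of these.\<close>

definition gset_class ::
    "('a, 'm) monoid_scheme \<Rightarrow> ('a, 'b) gset \<Rightarrow> ('a, nat) gset set" where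
  "gset_class G X = {Y. finite_gset G Y \<and> gset_iso G X Y}"

definition gset_semiring ::
    "('a, 'm) monoid_scheme \<Rightarrow> ('a set \<times> 'a set) set \<Rightarrow> ('a, nat) gset set ring" where
  "gset_semiring G \<O> =
     \<lparr>carrier = gset_class G ` {X :: ('a, nat) gset. finite_gset G X \<and> admissible_gset G \<O> X},
      mult = (\<lambda>C D. \<Union>X\<in>C. \<Union>Y\<in>D. gset_class G (gset_prod X Y)),
      one = gset_class G gset_point,
      zero = gset_class G gset_empty,
      add = (\<lambda>C D. \<Union>X\<in>C. \<Union>Y\<in>D. gset_class G (gset_sum X Y))\<rparr>"


section \<open>Grothendieck ring of a commutative semiring\<close>

text \<open>A pair \<open>(a, b)\<close> stands for the formal difference \<open>a - b\<close>.\<close>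

definition groth_rel :: "('r, 'm) ring_scheme \<Rightarrow> (('r \<times> 'r) \<times> ('r \<times> 'r)) set" where
  "groth_rel R =
     {((a, b), (c, d)). a \<in> carrier R \<and> b \<in> carrier R \<and> c \<in> carrier R \<and> d \<in> carrier R \<and>
        (\<exists>k\<in>carrier R. a \<oplus>\<^bsub>R\<^esub> d \<oplus>\<^bsub>R\<^esub> k = c \<oplus>\<^bsub>R\<^esub> b \<oplus>\<^bsub>R\<^esub> k)}"

definition grothendieck_ring :: "('r, 'm) ring_scheme \<Rightarrow> ('r \<times> 'r) set ring" where
  "grothendieck_ring R =
     \<lparr>carrier = (carrier R \<times> carrier R) // groth_rel R,
      mult = (\<lambda>X Y. \<Union>(a, b)\<in>X. \<Union>(c, d)\<in>Y.
                groth_rel R `` {(a \<otimes>\<^bsub>R\<^esub> c \<oplus>\<^bsub>R\<^esub> b \<otimes>\<^bsub>R\<^esub> d, a \<otimes>\<^bsub>R\<^esub> d \<oplus>\<^bsub>R\<^esub> b \<otimes>\<^bsub>R\<^esub> c)}),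
      one = groth_rel R `` {(\<one>\<^bsub>R\<^esub>, \<zero>\<^bsub>R\<^esub>)},
      zero = groth_rel R `` {(\<zero>\<^bsub>R\<^esub>, \<zero>\<^bsub>R\<^esub>)},
      add = (\<lambda>X Y. \<Union>(a, b)\<in>X. \<Union>(c, d)\<in>Y.
                groth_rel R `` {(a \<oplus>\<^bsub>R\<^esub> c, b \<oplus>\<^bsub>R\<^esub> d)})\<rparr>"

definition groth_of :: "('r, 'm) ring_scheme \<Rightarrow> 'r \<Rightarrow> ('r \<times> 'r) set" where
  "groth_of R a = groth_rel R `` {(a, \<zero>\<^bsub>R\<^esub>)}"

definition groth_extend :: "('r \<Rightarrow> rat) \<Rightarrow> ('r \<times> 'r) set \<Rightarrow> rat" where
  "groth_extend f X = the_elem ((\<lambda>(a, b). f a - f b) ` X)"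


section \<open>Rationalization of a commutative ring\<close>

text \<open>The tensor product with the rationals, realised as the ring of fractions with respect to
  the positive integers: the pair \<open>(x, m)\<close> stands for \<open>x / m\<close>. The factor \<open>k\<close> accounts for
  possible torsion.\<close>

definition rat_rel :: "('r, 'm) ring_scheme \<Rightarrow> (('r \<times> int) \<times> ('r \<times> int)) set" where
  "rat_rel R =
     {((x, m), (y, n)). x \<in> carrier R \<and> y \<in> carrier R \<and> m > 0 \<and> n > 0 \<and>
        (\<exists>k>0. [(k * n)] \<cdot>\<^bsub>R\<^esub> x = [(k * m)] \<cdot>\<^bsub>R\<^esub> y)}"

definition rationalization :: "('r, 'm) ring_scheme \<Rightarrow> (rat, ('r \<times> int) set) module" where
  "rationalization R =
     \<lparr>carrier = (carrier R \<times> {0<..}) // rat_rel R,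
      mult = (\<lambda>X Y. \<Union>(x, m)\<in>X. \<Union>(y, n)\<in>Y. rat_rel R `` {(x \<otimes>\<^bsub>R\<^esub> y, m * n)}),
      one = rat_rel R `` {(\<one>\<^bsub>R\<^esub>, 1)},
      zero = rat_rel R `` {(\<zero>\<^bsub>R\<^esub>, 1)},
      add = (\<lambda>X Y. \<Union>(x, m)\<in>X. \<Union>(y, n)\<in>Y.
               rat_rel R `` {([n] \<cdot>\<^bsub>R\<^esub> x \<oplus>\<^bsub>R\<^esub> [m] \<cdot>\<^bsub>R\<^esub> y, m * n)}),
      smult = (\<lambda>q X. \<Union>(x, m)\<in>X.
               rat_rel R `` {([(fst (quotient_of q))] \<cdot>\<^bsub>R\<^esub> x, snd (quotient_of q) * m)})\<rparr>"

definition rat_of_elem :: "('r, 'm) ring_scheme \<Rightarrow> 'r \<Rightarrow> ('r \<times> int) set" where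
  "rat_of_elem R x = rat_rel R `` {(x, 1)}"

definition rat_extend :: "('r \<Rightarrow> rat) \<Rightarrow> ('r \<times> int) set \<Rightarrow> rat" where
  "rat_extend f X = the_elem ((\<lambda>(x, m). f x / of_int m) ` X)"


section \<open>The rational incomplete Burnside ring and its idempotents\<close>

type_synonym 'a burnside = "((('a, nat) gset set \<times> ('a, nat) gset set) set \<times> int) set"

definition burnside_ring ::
    "('a, 'm) monoid_scheme \<Rightarrow> ('a set \<times> 'a set) set \<Rightarrow> (rat, 'a burnside) module" where
  "burnside_ring G \<O> = rationalization (grothendieck_ring (gset_semiring G \<O>))"

definition burnside_elem ::
    "('a, 'm) monoid_scheme \<Rightarrow> ('a set \<times> 'a set) set \<Rightarrow> ('a, 'b) gset \<Rightarrow> 'a burnside" where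
  "burnside_elem G \<O> X =
     rat_of_elem (grothendieck_ring (gset_semiring G \<O>))
       (groth_of (gset_semiring G \<O>) (gset_class G X))"

definition class_mark :: "'a set \<Rightarrow> ('a, nat) gset set \<Rightarrow> rat" where
  "class_mark K C = the_elem ((\<lambda>X. of_nat (card (fixed_points X K))) ` C)"

text \<open>The additive, rational-linear extension of \<open>T \<mapsto> (K \<mapsto> card (T\<^sup>K))\<close>. Functions on the
  admissible subgroups are represented as extensional functions.\<close>

definition burnside_marks ::
    "('a, 'm) monoid_scheme \<Rightarrow> ('a set \<times> 'a set) set \<Rightarrow> 'a burnside \<Rightarrow> 'a set \<Rightarrow> rat" where
  "burnside_marks G \<O> x =
     (\<lambda>K\<in>admissible_subgroups G \<O>. rat_extend (groth_extend (class_mark K)) x)"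

definition class_indicator ::
    "('a, 'm) monoid_scheme \<Rightarrow> ('a set \<times> 'a set) set \<Rightarrow> 'a set \<Rightarrow> 'a set \<Rightarrow> rat" where
  "class_indicator G \<O> H =
     (\<lambda>L\<in>admissible_subgroups G \<O>. if \<exists>g\<in>carrier G. L = conj_subgroup G g H then 1 else 0)"

text \<open>For a transfer system on a finite group, \<open>burnside_marks\<close> is the ring isomorphism from the
  Burnside ring onto the conjugation-invariant functions, and the idempotent is the preimage of the
  indicator function of the conjugacy class of \<open>H\<close>.\<close>

definition burnside_idempotent ::
    "('a, 'm) monoid_scheme \<Rightarrow> ('a set \<times> 'a set) set \<Rightarrow> 'a set \<Rightarrow> 'a burnside" where
  "burnside_idempotent G \<O> H =
     the_inv_into (carrier (burnside_ring G \<O>)) (burnside_marks G \<O>) (class_indicator G \<O> H)"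

end

theory Submission
  imports Defs
begin

text \<open>All marks together separate the elements of the incomplete Burnside ring: by Burnside's theorem
  a finite \<open>G\<close>-set with admissible orbits is determined up to isomorphism by its numbers of fixed points
  under admissible subgroups, and this separation property passes to the Grothendieck ring and to its
  rationalization. So it suffices to compare the marks of both sides at an admissible \<open>L\<close>. There
  \<open>|K| |(G/K)\<^sup>L|\<close> counts the \<open>g \<in> G\<close> with \<open>M = g\<inverse> L g \<subseteq> K\<close>; as \<open>M\<close> is admissible,
  restriction turns this inclusion into \<open>M \<rightarrow> K\<close>. Moebius inversion, \<open>\<Sum> \<mu>(K, H) = [M = H]\<close> over
  \<open>M \<rightarrow> K \<rightarrow> H\<close>, leaves the number of \<open>g\<close> conjugating \<open>H\<close> to \<open>L\<close>, which is \<open>|N\<^sub>G H|\<close> or \<open>0\<close>.\<close>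


section \<open>Separating families of additive functions\<close>

text \<open>The rings here are quotients of pairs of sets of G-sets, so checking each law and each
  choice of representatives by hand would be painful. \<open>separated_monoid\<close> isolates what
  survives every construction: an addition together with additive rational-valued functions that
  jointly separate the elements. Any identity in such a structure, the monoid laws included, becomes
  an identity of rational numbers, and the relations \<open>groth_rel\<close> and
  \<open>rat_rel\<close> become equality of the numbers \<open>f i a - f i b\<close> and
  \<open>f i x / of_int m\<close>. Burnside's theorem enters only at the bottom level.

  Admissible subgroups suffice as tests in Burnside's theorem because the stabilizers in an
  admissible G-set are themselves admissible: a stabilizer in G/K is a conjugate of K. The
  idempotent is given as an inverse image under the marks, so a candidate is recognised by its marks
  as soon as the marks are injective and the candidate lies in the carrier.\<close>

locale separated_monoid =
  fixes R :: "('r, 'm) ring_scheme" (structure) and I :: "'i set" and f :: "'i \<Rightarrow> 'r \<Rightarrow> rat"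
  assumes zero_closed: "\<zero> \<in> carrier R"
    and add_closed: "x \<in> carrier R \<Longrightarrow> y \<in> carrier R \<Longrightarrow> x \<oplus> y \<in> carrier R"
    and f_zero: "i \<in> I \<Longrightarrow> f i \<zero> = 0"
    and f_add: "i \<in> I \<Longrightarrow> x \<in> carrier R \<Longrightarrow> y \<in> carrier R \<Longrightarrow> f i (x \<oplus> y) = f i x + f i y"
    and separated: "x \<in> carrier R \<Longrightarrow> y \<in> carrier R \<Longrightarrow> (\<And>i. i \<in> I \<Longrightarrow> f i x = f i y) \<Longrightarrow> x = y"
begin

text \<open>Commutativity, associativity and the unit law hold after applying any
  \<open>f i\<close>, where they are laws of rational addition; separation pulls them back.\<close>

sublocale abelian_monoid R
  by (rule abelian_monoidI)
    (auto intro!: separated add_closed zero_closed simp: f_add f_zero add_closed zero_closed)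

lemma f_finsum:
  assumes "i \<in> I" "finite A" "g \<in> A \<rightarrow> carrier R"
  shows "f i (finsum R g A) = (\<Sum>a\<in>A. f i (g a))"
  using assms(2,3) by (induction) (auto simp: finsum_insert f_zero f_add assms(1) Pi_def finsum_closed)

text \<open>The stabilizing summand \<open>k\<close> of the definition cancels once
  \<open>f i\<close> is applied. Conversely, separation makes the monoid cancellative, so
  \<open>\<zero>\<close> already serves as \<open>k\<close>.\<close>

lemma groth_rel_iff:
  "((a, b), (c, d)) \<in> groth_rel R \<longleftrightarrow>
     a \<in> carrier R \<and> b \<in> carrier R \<and> c \<in> carrier R \<and> d \<in> carrier R \<and>
     (\<forall>i\<in>I. f i a - f i b = f i c - f i d)" (is "?L \<longleftrightarrow> ?R")
proof
  assume ?L
  then obtain k where abcd: "a \<in> carrier R" "b \<in> carrier R" "c \<in> carrier R" "d \<in> carrier R"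
    and k: "k \<in> carrier R" and eq: "a \<oplus> d \<oplus> k = c \<oplus> b \<oplus> k"
    by (auto simp: groth_rel_def)
  have "f i a + f i d + f i k = f i c + f i b + f i k" if "i \<in> I" for i
    using arg_cong[OF eq, of "f i"] that abcd k by (simp add: f_add)
  then show ?R using abcd by (force simp: algebra_simps)
next
  assume R: ?R
  then have "a \<oplus> d \<oplus> \<zero> = c \<oplus> b \<oplus> \<zero>"
    by (intro separated) (auto simp: f_add f_zero algebra_simps)
  with R zero_closed show ?L by (auto simp: groth_rel_def)
qed

lemma equiv_groth_rel: "equiv (carrier R \<times> carrier R) (groth_rel R)"
proof (rule equivI)
  show "sym (groth_rel R)"
    by (rule symI) (force simp: groth_rel_iff)
  show "trans (groth_rel R)"
    by (rule transI) (force simp: groth_rel_iff)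
qed (auto simp: refl_on_def groth_rel_iff)

end

text \<open>Serves to evaluate \<open>groth_extend\<close> and \<open>rat_extend\<close>, which are
  \<open>the_elem\<close> of the image of a whole class: a function constant on a class has a
  singleton image.\<close>

lemma the_elem_image_class:
  assumes "equiv A r" "a \<in> A" "\<And>x. (a, x) \<in> r \<Longrightarrow> h x = h a"
  shows "the_elem (h ` (r `` {a})) = h a"
proof -
  have "h ` (r `` {a}) = {h a}" using assms(3) equiv_class_self[OF assms(1,2)] by blast
  then show ?thesis by simp
qed

context separated_monoid
begin

lemma groth_extend_class:
  assumes "i \<in> I" "a \<in> carrier R" "b \<in> carrier R"
  shows "groth_extend (f i) (groth_rel R `` {(a, b)}) = f i a - f i b"
  unfolding groth_extend_def using assms
  by (subst the_elem_image_class[OF equiv_groth_rel]) (auto simp: groth_rel_iff)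

lemma carrier_groth: "carrier (grothendieck_ring R) = (carrier R \<times> carrier R) // groth_rel R"
  by (simp add: grothendieck_ring_def)

lemma groth_carrierE:
  assumes "x \<in> carrier (grothendieck_ring R)"
  obtains a b where "a \<in> carrier R" "b \<in> carrier R" "x = groth_rel R `` {(a, b)}"
  using assms unfolding carrier_groth by (auto elim!: quotientE)

lemma groth_class_closed:
  "a \<in> carrier R \<Longrightarrow> b \<in> carrier R \<Longrightarrow> groth_rel R `` {(a, b)} \<in> carrier (grothendieck_ring R)"
  unfolding carrier_groth by (auto intro: quotientI)

lemma groth_class_eq:
  assumes "((a, b), (c, d)) \<in> groth_rel R"
  shows "groth_rel R `` {(a, b)} = groth_rel R `` {(c, d)}"
  by (rule equiv_class_eq[OF equiv_groth_rel assms])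

lemma groth_add:
  assumes "a \<in> carrier R" "b \<in> carrier R" "c \<in> carrier R" "d \<in> carrier R"
  shows "groth_rel R `` {(a, b)} \<oplus>\<^bsub>grothendieck_ring R\<^esub> groth_rel R `` {(c, d)} =
    groth_rel R `` {(a \<oplus> c, b \<oplus> d)}"
proof -
  have "congruent2 (groth_rel R) (groth_rel R)
     (\<lambda>p q. groth_rel R `` {(fst p \<oplus> fst q, snd p \<oplus> snd q)})"
    by (rule congruent2I') (auto intro!: groth_class_eq simp: groth_rel_iff f_add algebra_simps)
  from UN_equiv_class2[OF equiv_groth_rel equiv_groth_rel this, of "(a, b)" "(c, d)"] assms
  show ?thesis by (simp add: grothendieck_ring_def case_prod_unfold)
qed

text \<open>By \<open>groth_rel_iff\<close>, pairs with the same values \<open>f i a - f i b\<close>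
  are already related, so separation passes to the quotient.\<close>

lemma separated_grothendieck:
  "separated_monoid (grothendieck_ring R) I (\<lambda>i. groth_extend (f i))"
proof
  have zero: "\<zero>\<^bsub>grothendieck_ring R\<^esub> = groth_rel R `` {(\<zero>, \<zero>)}"
    by (simp add: grothendieck_ring_def)
  show "\<zero>\<^bsub>grothendieck_ring R\<^esub> \<in> carrier (grothendieck_ring R)"
    by (simp add: zero groth_class_closed)
  show "groth_extend (f i) \<zero>\<^bsub>grothendieck_ring R\<^esub> = 0" if "i \<in> I" for i
    using that by (simp add: zero groth_extend_class)
  fix x y assume xy: "x \<in> carrier (grothendieck_ring R)" "y \<in> carrier (grothendieck_ring R)"
  obtain a b c d where abcd: "a \<in> carrier R" "b \<in> carrier R" "c \<in> carrier R" "d \<in> carrier R"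
    and x: "x = groth_rel R `` {(a, b)}" and y: "y = groth_rel R `` {(c, d)}"
    using xy by (auto elim!: groth_carrierE)
  show "x \<oplus>\<^bsub>grothendieck_ring R\<^esub> y \<in> carrier (grothendieck_ring R)"
    using abcd by (simp add: x y groth_add groth_class_closed)
  show "groth_extend (f i) (x \<oplus>\<^bsub>grothendieck_ring R\<^esub> y) = groth_extend (f i) x + groth_extend (f i) y"
    if "i \<in> I" for i
    using abcd that by (simp add: x y groth_add groth_extend_class f_add)
  show "x = y" if "\<And>i. i \<in> I \<Longrightarrow> groth_extend (f i) x = groth_extend (f i) y"
    using abcd that unfolding x y
    by (intro groth_class_eq) (simp add: groth_rel_iff groth_extend_class)
qed

text \<open>Inverses are what gives meaning to integer multiples with a negative factor, which occur
  as numerators of scalars in the rationalization.\<close>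

lemma abelian_group_grothendieck: "abelian_group (grothendieck_ring R)"
proof -
  interpret K: separated_monoid "grothendieck_ring R" I "\<lambda>i. groth_extend (f i)"
    by (rule separated_grothendieck)
  show ?thesis
  proof (rule abelian_groupI)
    fix x assume x: "x \<in> carrier (grothendieck_ring R)"
    then obtain a b where ab: "a \<in> carrier R" "b \<in> carrier R" "x = groth_rel R `` {(a, b)}"
      by (auto elim!: groth_carrierE)
    \<comment> \<open>Exchanging the two entries of a pair negates every value, so
      \<open>(b, a)\<close> represents the inverse of \<open>(a, b)\<close>.\<close>
    then have "groth_rel R `` {(b, a)} \<oplus>\<^bsub>grothendieck_ring R\<^esub> x = \<zero>\<^bsub>grothendieck_ring R\<^esub>"
      by (intro K.separated)
        (auto simp: K.f_zero K.f_add x groth_extend_class groth_class_closed)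
    then show "\<exists>y\<in>carrier (grothendieck_ring R).
        y \<oplus>\<^bsub>grothendieck_ring R\<^esub> x = \<zero>\<^bsub>grothendieck_ring R\<^esub>"
      using ab groth_class_closed by blast
  qed (simp_all add: K.a_ac)
qed

lemma groth_of_closed: "a \<in> carrier R \<Longrightarrow> groth_of R a \<in> carrier (grothendieck_ring R)"
  by (simp add: groth_of_def groth_class_closed)

lemma groth_extend_groth_of:
  "i \<in> I \<Longrightarrow> a \<in> carrier R \<Longrightarrow> groth_extend (f i) (groth_of R a) = f i a"
  by (simp add: groth_of_def groth_extend_class f_zero)

end

section \<open>Rationalization of a separated abelian group\<close>

locale separated_group = separated_monoid + abelian_group R
begin

lemma f_uminus: "i \<in> I \<Longrightarrow> x \<in> carrier R \<Longrightarrow> f i (\<ominus> x) = - f i x"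
  using f_add[of i "\<ominus> x" x] by (simp add: l_neg f_zero)

lemma f_add_pow_nat:
  "i \<in> I \<Longrightarrow> x \<in> carrier R \<Longrightarrow> f i ([(n::nat)] \<cdot> x) = of_nat n * f i x"
  by (induction n) (simp_all add: f_zero f_add algebra_simps)

lemma f_add_pow:
  assumes "i \<in> I" "x \<in> carrier R"
  shows "f i ([(k::int)] \<cdot> x) = of_int k * f i x"
  using assms
  by (cases "k \<ge> 0") (simp_all add: add_pow_int_ge add_pow_int_lt f_uminus f_add_pow_nat)

text \<open>Values are rational numbers, where the positive factor \<open>k\<close> of the
  definition cancels. Conversely, a separated group has no torsion, so \<open>k = 1\<close> is
  enough.\<close>

lemma rat_rel_iff:
  "((x, m), (y, n)) \<in> rat_rel R \<longleftrightarrow>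
     x \<in> carrier R \<and> y \<in> carrier R \<and> m > 0 \<and> n > 0 \<and>
     (\<forall>i\<in>I. f i x / of_int m = f i y / of_int n)" (is "?L \<longleftrightarrow> ?R")
proof
  assume ?L
  then obtain k where xy: "x \<in> carrier R" "y \<in> carrier R" "m > 0" "n > 0"
    and k: "k > 0" and eq: "[(k * n)] \<cdot> x = [(k * m)] \<cdot> y"
    by (auto simp: rat_rel_def)
  have "f i x / of_int m = f i y / of_int n" if "i \<in> I" for i
    using arg_cong[OF eq, of "f i"] that xy k by (simp add: f_add_pow field_simps)
  then show ?R using xy by auto
next
  assume R: ?R
  have "[n] \<cdot> x = [m] \<cdot> y"
  proof (rule separated)
    fix i assume "i \<in> I"
    with R have "f i x / of_int m = f i y / of_int n" and "m > 0" "n > 0" by auto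
    then have "of_int n * f i x = of_int m * f i y"
      by (simp add: field_simps)
    then show "f i ([n] \<cdot> x) = f i ([m] \<cdot> y)"
      using R \<open>i \<in> I\<close> by (simp add: f_add_pow)
  qed (use R in auto)
  then have "\<exists>k>0. [(k * n)] \<cdot> x = [(k * m)] \<cdot> y"
    by (intro exI[of _ 1]) simp
  with R show ?L unfolding rat_rel_def by simp
qed

lemma equiv_rat_rel: "equiv (carrier R \<times> {0<..}) (rat_rel R)"
proof (rule equivI)
  show "sym (rat_rel R)"
    by (rule symI) (force simp: rat_rel_iff)
  show "trans (rat_rel R)"
    by (rule transI) (force simp: rat_rel_iff)
qed (auto simp: refl_on_def rat_rel_iff)

lemma rat_extend_class:
  assumes "i \<in> I" "x \<in> carrier R" "m > 0"
  shows "rat_extend (f i) (rat_rel R `` {(x, m)}) = f i x / of_int m"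
  unfolding rat_extend_def using assms
  by (subst the_elem_image_class[OF equiv_rat_rel]) (auto simp: rat_rel_iff)

lemma carrier_rationalization: "carrier (rationalization R) = (carrier R \<times> {0<..}) // rat_rel R"
  by (simp add: rationalization_def)

lemma rat_carrierE:
  assumes "x \<in> carrier (rationalization R)"
  obtains a m where "a \<in> carrier R" "m > 0" "x = rat_rel R `` {(a, m)}"
  using assms unfolding carrier_rationalization by (auto elim!: quotientE)

lemma rat_class_closed:
  "a \<in> carrier R \<Longrightarrow> m > 0 \<Longrightarrow> rat_rel R `` {(a, m)} \<in> carrier (rationalization R)"
  unfolding carrier_rationalization by (auto intro: quotientI)

lemma rat_class_eq:
  assumes "((a, b), (c, d)) \<in> rat_rel R"
  shows "rat_rel R `` {(a, b)} = rat_rel R `` {(c, d)}"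
  by (rule equiv_class_eq[OF equiv_rat_rel assms])

lemma rat_add:
  assumes "x \<in> carrier R" "y \<in> carrier R" "m > 0" "n > 0"
  shows "rat_rel R `` {(x, m)} \<oplus>\<^bsub>rationalization R\<^esub> rat_rel R `` {(y, n)} =
    rat_rel R `` {([n] \<cdot> x \<oplus> [m] \<cdot> y, m * n)}"
proof -
  have "congruent2 (rat_rel R) (rat_rel R)
     (\<lambda>p q. rat_rel R `` {([snd q] \<cdot> fst p \<oplus> [snd p] \<cdot> fst q, snd p * snd q)})"
    by (rule congruent2I')
      (auto intro!: rat_class_eq simp: rat_rel_iff f_add f_add_pow add_divide_distrib)
  from UN_equiv_class2[OF equiv_rat_rel equiv_rat_rel this, of "(x, m)" "(y, n)"] assms
  show ?thesis by (simp add: rationalization_def case_prod_unfold)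
qed

text \<open>On values the operation is multiplication by numerator over denominator of
  \<open>q\<close>, hence independent of the representative; the denominator from
  \<open>quotient_of\<close> is positive, as the classes demand.\<close>

lemma rat_smult:
  assumes "x \<in> carrier R" "m > 0"
  shows "q \<odot>\<^bsub>rationalization R\<^esub> rat_rel R `` {(x, m)} =
    rat_rel R `` {([fst (quotient_of q)] \<cdot> x, snd (quotient_of q) * m)}"
proof -
  have "(\<lambda>p. rat_rel R `` {([fst (quotient_of q)] \<cdot> fst p, snd (quotient_of q) * snd p)})
      respects rat_rel R"
  proof (rule congruentI, clarify, rule rat_class_eq)
    fix y n z k assume yz: "((y, n), (z, k)) \<in> rat_rel R"
    have "f i y / of_int n = f i z / of_int k" if "i \<in> I" for i
      using yz that by (auto simp: rat_rel_iff)
    then have "of_int (fst (quotient_of q)) / of_int (snd (quotient_of q)) * (f i y / of_int n) =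
        of_int (fst (quotient_of q)) / of_int (snd (quotient_of q)) * (f i z / of_int k)" if "i \<in> I" for i
      using that by simp
    then show "(([fst (quotient_of q)] \<cdot> fst (y, n), snd (quotient_of q) * snd (y, n)),
        ([fst (quotient_of q)] \<cdot> fst (z, k), snd (quotient_of q) * snd (z, k))) \<in> rat_rel R"
      using yz by (simp add: rat_rel_iff f_add_pow quotient_of_denom_pos')
  qed
  from UN_equiv_class[OF equiv_rat_rel this, of "(x, m)"] assms
  show ?thesis by (simp add: rationalization_def case_prod_unfold)
qed

lemma separated_rationalization:
  "separated_monoid (rationalization R) I (\<lambda>i. rat_extend (f i))"
proof
  have zero: "\<zero>\<^bsub>rationalization R\<^esub> = rat_rel R `` {(\<zero>, 1)}"
    by (simp add: rationalization_def)
  show "\<zero>\<^bsub>rationalization R\<^esub> \<in> carrier (rationalization R)"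
    by (simp add: zero rat_class_closed)
  show "rat_extend (f i) \<zero>\<^bsub>rationalization R\<^esub> = 0" if "i \<in> I" for i
    using that by (simp add: zero rat_extend_class f_zero)
  fix x y assume xy: "x \<in> carrier (rationalization R)" "y \<in> carrier (rationalization R)"
  obtain a b m n where ab: "a \<in> carrier R" "b \<in> carrier R" "m > 0" "n > 0"
    and x: "x = rat_rel R `` {(a, m)}" and y: "y = rat_rel R `` {(b, n)}"
    using xy by (auto elim!: rat_carrierE)
  show "x \<oplus>\<^bsub>rationalization R\<^esub> y \<in> carrier (rationalization R)"
    using ab by (simp add: x y rat_add rat_class_closed)
  show "rat_extend (f i) (x \<oplus>\<^bsub>rationalization R\<^esub> y) = rat_extend (f i) x + rat_extend (f i) y"
    if "i \<in> I" for i
    using ab that by (simp add: x y rat_add rat_extend_class f_add f_add_pow add_divide_distrib)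
  show "x = y" if "\<And>i. i \<in> I \<Longrightarrow> rat_extend (f i) x = rat_extend (f i) y"
    using ab that unfolding x y
    by (intro rat_class_eq) (simp add: rat_rel_iff rat_extend_class)
qed

lemma smult_closed:
  "x \<in> carrier (rationalization R) \<Longrightarrow> q \<odot>\<^bsub>rationalization R\<^esub> x \<in> carrier (rationalization R)"
  by (auto elim!: rat_carrierE simp: rat_smult rat_class_closed quotient_of_denom_pos')

lemma rat_extend_smult:
  assumes "i \<in> I" "x \<in> carrier (rationalization R)"
  shows "rat_extend (f i) (q \<odot>\<^bsub>rationalization R\<^esub> x) = q * rat_extend (f i) x"
proof -
  obtain a m where x: "a \<in> carrier R" "m > 0" "x = rat_rel R `` {(a, m)}"
    using assms(2) by (auto elim!: rat_carrierE)
  have "q = of_int (fst (quotient_of q)) / of_int (snd (quotient_of q))"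
    by (metis quotient_of_div prod.collapse)
  then have "q * (f i a / of_int m) =
      of_int (fst (quotient_of q)) / of_int (snd (quotient_of q)) * (f i a / of_int m)"
    by (rule arg_cong)
  with assms(1) x show ?thesis
    by (simp add: rat_smult rat_extend_class quotient_of_denom_pos' f_add_pow)
qed

lemma rat_of_elem_closed: "a \<in> carrier R \<Longrightarrow> rat_of_elem R a \<in> carrier (rationalization R)"
  by (simp add: rat_of_elem_def rat_class_closed)

lemma rat_extend_rat_of_elem:
  "i \<in> I \<Longrightarrow> a \<in> carrier R \<Longrightarrow> rat_extend (f i) (rat_of_elem R a) = f i a"
  by (simp add: rat_of_elem_def rat_extend_class)

end


section \<open>Isomorphisms and orbits of finite G-sets\<close>

text \<open>\<open>group_action\<close> asks for a homomorphism into \<open>BijGroup E\<close>.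
  Bijectivity of \<open>\<phi> g\<close> comes from the inverse map \<open>\<phi> (inv g)\<close>;
  extensionality is assumed because \<open>Bij E\<close> contains only extensional maps.\<close>

lemma group_actionI:
  fixes G (structure)
  assumes "group G"
    and ext: "\<And>g. g \<in> carrier G \<Longrightarrow> \<phi> g \<in> extensional E"
    and closed: "\<And>g x. g \<in> carrier G \<Longrightarrow> x \<in> E \<Longrightarrow> \<phi> g x \<in> E"
    and one: "\<And>x. x \<in> E \<Longrightarrow> \<phi> \<one> x = x"
    and mult: "\<And>g h x. g \<in> carrier G \<Longrightarrow> h \<in> carrier G \<Longrightarrow> x \<in> E \<Longrightarrow> \<phi> (g \<otimes> h) x = \<phi> g (\<phi> h x)"
  shows "group_action G E \<phi>"
proof -
  interpret group G by fact
  have bij: "\<phi> g \<in> Bij E" if g: "g \<in> carrier G" for g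
  proof -
    have "bij_betw (\<phi> g) E E"
      by (rule bij_betw_byWitness[where f' = "\<phi> (inv g)"])
        (use g in \<open>auto simp: closed mult[symmetric] one\<close>)
    then show ?thesis using ext[OF g] by (simp add: Bij_def)
  qed
  have "\<phi> \<in> hom G (BijGroup E)"
  proof (rule homI)
    fix g h assume gh: "g \<in> carrier G" "h \<in> carrier G"
    show "\<phi> (g \<otimes> h) = \<phi> g \<otimes>\<^bsub>BijGroup E\<^esub> \<phi> h"
    proof (rule extensionalityI[of _ E])
      show "\<phi> g \<otimes>\<^bsub>BijGroup E\<^esub> \<phi> h \<in> extensional E"
        using bij gh by (simp add: BijGroup_def compose_extensional)
    qed (use gh bij in \<open>auto simp: BijGroup_def ext mult compose_eq\<close>)
  qed (simp add: BijGroup_def bij)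
  then show ?thesis
    by (simp add: group_action_def group_hom_def group_hom_axioms_def is_group group_BijGroup)
qed

lemma gset_iso_refl: "gset_iso G X X"
  unfolding gset_iso_def by (intro exI[of _ id]) simp

lemma gset_iso_trans: "gset_iso G X Y \<Longrightarrow> gset_iso G Y Z \<Longrightarrow> gset_iso G X Z"
proof -
  assume "gset_iso G X Y" "gset_iso G Y Z"
  then obtain f h where
    f: "bij_betw f (fst X) (fst Y)" "\<forall>g\<in>carrier G. \<forall>x\<in>fst X. f (snd X g x) = snd Y g (f x)" and
    h: "bij_betw h (fst Y) (fst Z)" "\<forall>g\<in>carrier G. \<forall>x\<in>fst Y. h (snd Y g x) = snd Z g (h x)"
    unfolding gset_iso_def by blast
  then have "bij_betw (h \<circ> f) (fst X) (fst Z)"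
    by (blast intro: bij_betw_trans)
  moreover have "\<forall>g\<in>carrier G. \<forall>x\<in>fst X. (h \<circ> f) (snd X g x) = snd Z g ((h \<circ> f) x)"
    using f h by (simp add: bij_betwE)
  ultimately show ?thesis unfolding gset_iso_def by blast
qed

lemma gset_iso_gset_sum:
  assumes "gset_iso G X X'" "gset_iso G Y Y'"
  shows "gset_iso G (gset_sum X Y) (gset_sum X' Y')"
proof -
  obtain f where
    f: "bij_betw f (fst X) (fst X')" "\<forall>g\<in>carrier G. \<forall>x\<in>fst X. f (snd X g x) = snd X' g (f x)"
    using assms(1) unfolding gset_iso_def by blast
  obtain h where
    h: "bij_betw h (fst Y) (fst Y')" "\<forall>g\<in>carrier G. \<forall>x\<in>fst Y. h (snd Y g x) = snd Y' g (h x)"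
    using assms(2) unfolding gset_iso_def by blast
  have "bij_betw (map_sum f h) (fst X <+> fst Y) (fst X' <+> fst Y')"
  proof (rule bij_betw_imageI)
    show "inj_on (map_sum f h) (fst X <+> fst Y)"
      by (rule inj_onI)
        (use f(1) h(1) in \<open>auto simp: bij_betw_def elim!: PlusE dest: inj_onD\<close>)
    have "map_sum f h ` (fst X <+> fst Y) = f ` fst X <+> h ` fst Y"
      by (simp add: Plus_def image_Un image_image)
    then show "map_sum f h ` (fst X <+> fst Y) = fst X' <+> fst Y'"
      using f(1) h(1) by (simp add: bij_betw_def)
  qed
  moreover have "map_sum f h (snd (gset_sum X Y) g z) = snd (gset_sum X' Y') g (map_sum f h z)"
    if "g \<in> carrier G" "z \<in> fst X <+> fst Y" for g z
    using that(2)
  proof (rule PlusE)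
    fix x assume x: "x \<in> fst X" "z = Inl x"
    then have "f x \<in> fst X'" using f(1) by (simp add: bij_betw_apply)
    then show ?thesis using f(2) x that(1) by (simp add: gset_sum_def InlI)
  next
    fix y assume y: "y \<in> fst Y" "z = Inr y"
    then have "h y \<in> fst Y'" using h(1) by (simp add: bij_betw_apply)
    then show ?thesis using h(2) y that(1) by (simp add: gset_sum_def InrI)
  qed
  ultimately show ?thesis
    unfolding gset_iso_def by (intro exI[of _ "map_sum f h"]) (simp add: gset_sum_def)
qed

text \<open>The action is cut down to an extensional one so that an invariant \<open>S\<close> gives
  a \<open>group_action\<close> again; for an orbit this is literally the pair occurring in
  \<open>admissible_gset\<close>.\<close>

definition gset_on :: "('a, 'b) gset \<Rightarrow> 'b set \<Rightarrow> ('a, 'b) gset" where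
  "gset_on X S = (S, \<lambda>g. restrict (snd X g) S)"

text \<open>The piecewise map is equivariant because the action never moves a point of
  \<open>X\<close> from one piece to the other. This reassembles an isomorphism after one orbit has
  been split off.\<close>

lemma gset_iso_glue:
  assumes "S \<subseteq> fst X" "T \<subseteq> fst Y"
    and closed: "\<And>g x. g \<in> carrier G \<Longrightarrow> x \<in> S \<Longrightarrow> snd X g x \<in> S"
      "\<And>g x. g \<in> carrier G \<Longrightarrow> x \<in> fst X - S \<Longrightarrow> snd X g x \<in> fst X - S"
    and "gset_iso G (gset_on X S) (gset_on Y T)"
    and "gset_iso G (gset_on X (fst X - S)) (gset_on Y (fst Y - T))"
  shows "gset_iso G X Y"
proof -
  obtain f where f: "bij_betw f (fst (gset_on X S)) (fst (gset_on Y T))"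
    "\<forall>g\<in>carrier G. \<forall>x\<in>fst (gset_on X S). f (snd (gset_on X S) g x) = snd (gset_on Y T) g (f x)"
    using assms(5) unfolding gset_iso_def by blast
  have f_bij: "bij_betw f S T" using f(1) by (simp add: gset_on_def)
  have f_act: "f (snd X g x) = snd Y g (f x)" if "g \<in> carrier G" "x \<in> S" for g x
    using f(2) that bij_betw_apply[OF f_bij] by (simp add: gset_on_def)
  obtain h where h: "bij_betw h (fst (gset_on X (fst X - S))) (fst (gset_on Y (fst Y - T)))"
    "\<forall>g\<in>carrier G. \<forall>x\<in>fst (gset_on X (fst X - S)). h (snd (gset_on X (fst X - S)) g x) = snd (gset_on Y (fst Y - T)) g (h x)"
    using assms(6) unfolding gset_iso_def by blast
  have h_bij: "bij_betw h (fst X - S) (fst Y - T)" using h(1) by (simp add: gset_on_def)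
  have h_act: "h (snd X g x) = snd Y g (h x)" if "g \<in> carrier G" "x \<in> (fst X - S)" for g x
    using h(2) that bij_betw_apply[OF h_bij] by (simp add: gset_on_def)
  define k where "k = (\<lambda>x. if x \<in> S then f x else h x)"
  have "bij_betw k S T \<longleftrightarrow> bij_betw f S T"
    by (rule bij_betw_cong) (simp add: k_def)
  moreover have "bij_betw k (fst X - S) (fst Y - T) \<longleftrightarrow> bij_betw h (fst X - S) (fst Y - T)"
    by (rule bij_betw_cong) (simp add: k_def)
  ultimately have "bij_betw k (S \<union> (fst X - S)) (T \<union> (fst Y - T))"
    using f_bij h_bij by (intro bij_betw_combine) auto
  then have "bij_betw k (fst X) (fst Y)"
    using assms(1,2) by (simp add: Un_absorb1)
  moreover have "k (snd X g x) = snd Y g (k x)" if "g \<in> carrier G" "x \<in> fst X" for g x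
    using that closed f_act h_act by (cases "x \<in> S") (auto simp: k_def)
  ultimately show ?thesis unfolding gset_iso_def by blast
qed

lemma fixed_points_gset_on: "S \<subseteq> fst X \<Longrightarrow> fixed_points (gset_on X S) K = fixed_points X K \<inter> S"
  by (auto simp: fixed_points_def gset_on_def)

lemma fixed_points_gset_sum:
  "fixed_points (gset_sum X Y) K = fixed_points X K <+> fixed_points Y K"
  by (auto simp: fixed_points_def gset_sum_def)

lemma card_fixed_points_iso:
  assumes "gset_iso G X Y" "K \<subseteq> carrier G" "\<And>g x. g \<in> carrier G \<Longrightarrow> x \<in> fst X \<Longrightarrow> snd X g x \<in> fst X"
  shows "card (fixed_points X K) = card (fixed_points Y K)"
proof -
  obtain f where f: "bij_betw f (fst X) (fst Y)"
    "\<And>g x. g\<in>carrier G \<Longrightarrow> x \<in> fst X \<Longrightarrow> f (snd X g x) = snd Y g (f x)"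
    using assms(1) unfolding gset_iso_def by blast
  have "f x \<in> fixed_points Y K \<longleftrightarrow> x \<in> fixed_points X K" if "x \<in> fst X" for x
  proof -
    \<comment> \<open>Injectivity of \<open>f\<close> is applied to \<open>snd X g x\<close> and
      \<open>x\<close>, so \<open>snd X g x\<close> has to lie in \<open>fst X\<close>.\<close>
    have "snd Y g (f x) = f x \<longleftrightarrow> snd X g x = x" if "g \<in> K" for g
      using that assms(2,3) f \<open>x \<in> fst X\<close> by (metis bij_betw_inv_into_left subsetD)
    then show ?thesis using that f(1) by (auto simp: fixed_points_def bij_betwE)
  qed
  moreover have "fixed_points X K \<subseteq> fst X" "fixed_points Y K \<subseteq> fst Y"
    by (auto simp: fixed_points_def)
  ultimately have "f ` fixed_points X K = fixed_points Y K"
    using f(1) by (auto simp: bij_betw_def subset_iff image_iff) (metis imageE)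
  then have "bij_betw f (fixed_points X K) (fixed_points Y K)"
    using bij_betw_subset[OF f(1) \<open>fixed_points X K \<subseteq> fst X\<close>] by simp
  then show ?thesis by (rule bij_betw_same_card)
qed

section \<open>Stabilizers, orbits and sums of finite G-sets\<close>

context
  fixes G :: "('a, 'm) monoid_scheme" (structure)
  assumes G: "group G"
begin

interpretation group G by (rule G)

context
  fixes X :: "('a, 'b) gset"
  assumes X: "finite_gset G X"
begin

interpretation group_action G "fst X" "snd X"
  using X by (simp add: finite_gset_def)

lemma gset_finite: "finite (fst X)"
  using X by (simp add: finite_gset_def)

lemma gset_act_closed: "g \<in> carrier G \<Longrightarrow> x \<in> fst X \<Longrightarrow> snd X g x \<in> fst X"
  using element_image by blast

lemma gset_act_one: "x \<in> fst X \<Longrightarrow> snd X \<one> x = x"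
  using id_eq_one by (metis restrict_apply')

lemma gset_act_mult:
  "g \<in> carrier G \<Longrightarrow> h \<in> carrier G \<Longrightarrow> x \<in> fst X \<Longrightarrow> snd X (g \<otimes> h) x = snd X g (snd X h x)"
  by (rule composition_rule)

text \<open>Pointwise form of orbit-stabilizer: the fibres of the map sending \<open>g\<close> to
  \<open>snd X g x\<close> are the left cosets of the stabilizer.\<close>

lemma gset_act_eq_iff:
  assumes "g \<in> carrier G" "h \<in> carrier G" "x \<in> fst X"
  shows "snd X g x = snd X h x \<longleftrightarrow> inv h \<otimes> g \<in> stabilizer G (snd X) x"
proof -
  have "snd X g x = snd X h x \<longleftrightarrow> snd X (inv h) (snd X g x) = x"
    using assms gset_act_closed orbit_sym_aux by (metis inv_closed inv_inv)
  then show ?thesis using assms by (simp add: stabilizer_def gset_act_mult)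
qed

lemma gset_orbit_closed:
  assumes "x \<in> fst X" "g \<in> carrier G" "z \<in> orbit G (snd X) x"
  shows "snd X g z \<in> orbit G (snd X) x"
  using assms unfolding orbit_def by (auto simp: gset_act_mult[symmetric])

lemma gset_orbit_subset: "x \<in> fst X \<Longrightarrow> orbit G (snd X) x \<subseteq> fst X"
  unfolding orbit_def using gset_act_closed by auto

lemma gset_orbit_refl: "x \<in> fst X \<Longrightarrow> x \<in> orbit G (snd X) x"
  by (rule orbit_refl)

lemma gset_orbit_compl_closed:
  assumes "x \<in> fst X" "g \<in> carrier G" "z \<in> fst X - orbit G (snd X) x"
  shows "snd X g z \<in> fst X - orbit G (snd X) x"
proof -
  have "z \<in> orbit G (snd X) x" if "snd X g z \<in> orbit G (snd X) x"
    using gset_orbit_closed[OF assms(1) inv_closed[OF assms(2)] that] assms orbit_sym_aux[of g z]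
    by auto
  with assms gset_act_closed show ?thesis by auto
qed

lemma finite_gset_on:
  assumes "S \<subseteq> fst X" "\<And>g x. g \<in> carrier G \<Longrightarrow> x \<in> S \<Longrightarrow> snd X g x \<in> S"
  shows "finite_gset G (gset_on X S)"
  unfolding finite_gset_def gset_on_def fst_conv snd_conv
proof
  show "group_action G S (\<lambda>g. restrict (snd X g) S)"
    using assms by (intro group_actionI) (auto simp: gset_act_one gset_act_mult subset_iff)
  show "finite S" using assms(1) gset_finite finite_subset by blast
qed

text \<open>Unlike reflexivity and transitivity, which hold for arbitrary pairs, symmetry needs
  \<open>X\<close> to be closed under its action: \<open>f\<close> is inverted at the point
  \<open>snd X g x\<close>.\<close>

lemma gset_iso_sym:
  assumes "gset_iso G X Y"
  shows "gset_iso G Y X"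
proof -
  obtain f where f: "bij_betw f (fst X) (fst Y)"
    "\<And>g x. g\<in>carrier G \<Longrightarrow> x \<in> fst X \<Longrightarrow> f (snd X g x) = snd Y g (f x)"
    using assms unfolding gset_iso_def by blast
  have "inv_into (fst X) f (snd Y g y) = snd X g (inv_into (fst X) f y)"
    if "g \<in> carrier G" "y \<in> fst Y" for g y
  proof -
    obtain x where "x \<in> fst X" "y = f x" using f(1) \<open>y \<in> fst Y\<close> by (auto simp: bij_betw_def)
    then show ?thesis
      using f that gset_act_closed by (metis bij_betw_inv_into_left)
  qed
  with bij_betw_inv_into[OF f(1)] show ?thesis unfolding gset_iso_def by blast
qed

lemma iso_stabilizer:
  assumes "bij_betw f (fst X) (fst Y)"
    "\<And>g x. g\<in>carrier G \<Longrightarrow> x \<in> fst X \<Longrightarrow> f (snd X g x) = snd Y g (f x)" "x \<in> fst X"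
  shows "stabilizer G (snd Y) (f x) = stabilizer G (snd X) x"
proof -
  have "snd Y g (f x) = f x \<longleftrightarrow> snd X g x = x" if "g \<in> carrier G" for g
    using assms that gset_act_closed by (metis bij_betw_inv_into_left)
  then show ?thesis by (auto simp: stabilizer_def)
qed

text \<open>Transport of structure along an injection. With an injection into the natural numbers it
  yields a member of \<open>gset_class\<close>, whatever the type of the points.\<close>

lemma gset_transport:
  assumes "inj_on f (fst X)"
  defines "Y \<equiv> (f ` fst X, \<lambda>g. \<lambda>y\<in>f ` fst X. f (snd X g (inv_into (fst X) f y)))"
  shows "finite_gset G Y" "gset_iso G X Y"
proof -
  show "finite_gset G Y"
    unfolding finite_gset_def Y_def fst_conv snd_conv
    using assms(1) gset_finite
    by (intro conjI group_actionI)
       (auto simp: gset_act_one gset_act_mult gset_act_closed inj_on_eq_iff[OF assms(1)])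
  show "gset_iso G X Y"
    unfolding gset_iso_def Y_def using assms(1)
    by (intro exI[of _ f]) (auto simp: bij_betw_def)
qed

lemma ex_nat_gset: "\<exists>Y :: ('a, nat) gset. finite_gset G Y \<and> gset_iso G X Y"
proof -
  obtain f :: "'b \<Rightarrow> nat" where "inj_on f (fst X)"
    using finite_imp_inj_to_nat_seg[OF gset_finite] by blast
  then show ?thesis using gset_transport by blast
qed

text \<open>Translates marks into statements about stabilizers, the form in which Burnside's theorem
  uses them.\<close>

lemma mem_fixed_points_iff:
  "K \<subseteq> carrier G \<Longrightarrow> x \<in> fixed_points X K \<longleftrightarrow> x \<in> fst X \<and> K \<subseteq> stabilizer G (snd X) x"
  by (auto simp: fixed_points_def stabilizer_def)

lemma stabilizer_gset_on:
  "x \<in> S \<Longrightarrow> stabilizer G (snd (gset_on X S)) x = stabilizer G (snd X) x"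
  by (simp add: stabilizer_def gset_on_def)

end

lemma finite_gset_sum:
  assumes "finite_gset G X" "finite_gset G Y"
  shows "finite_gset G (gset_sum X Y)"
  unfolding finite_gset_def gset_sum_def fst_conv snd_conv
proof
  show "group_action G (fst X <+> fst Y) (\<lambda>g. restrict (map_sum (snd X g) (snd Y g)) (fst X <+> fst Y))"
    by (rule group_actionI)
      (auto simp: assms gset_act_one gset_act_mult gset_act_closed)
qed (use assms in \<open>auto simp: finite_gset_def\<close>)

lemma finite_gset_empty: "finite_gset G gset_empty"
  unfolding finite_gset_def gset_empty_def fst_conv snd_conv
  by (intro conjI group_actionI) auto

text \<open>Both orbits are copies of G modulo the common stabilizer. The map sends the translate of
  \<open>x\<close> by \<open>g\<close> to the translate of \<open>y\<close> by \<open>g\<close>;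
  equal stabilizers make it independent of the chosen \<open>g\<close> and injective.\<close>

lemma orbit_iso:
  assumes X: "finite_gset G X" and Y: "finite_gset G Y" and "x \<in> fst X" "y \<in> fst Y"
    and stab: "stabilizer G (snd X) x = stabilizer G (snd Y) y"
  shows "gset_iso G (gset_on X (orbit G (snd X) x)) (gset_on Y (orbit G (snd Y) y))"
proof -
  define f where "f z = snd Y (SOME g. g \<in> carrier G \<and> snd X g x = z) y" for z
  have f: "f (snd X g x) = snd Y g y" if "g \<in> carrier G" for g
  proof -
    define h where "h = (SOME h. h \<in> carrier G \<and> snd X h x = snd X g x)"
    have "h \<in> carrier G \<and> snd X h x = snd X g x"
      unfolding h_def by (rule someI[of _ g]) (simp add: that)
    then have h: "h \<in> carrier G" "snd X h x = snd X g x" by auto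
    then have "snd Y h y = snd Y g y"
      using stab that assms by (simp add: gset_act_eq_iff)
    then show ?thesis by (simp add: f_def h_def)
  qed
  have "inj_on f (orbit G (snd X) x)"
  proof (rule inj_onI)
    fix z w assume "z \<in> orbit G (snd X) x" "w \<in> orbit G (snd X) x" and eq: "f z = f w"
    then obtain g h where gh: "g \<in> carrier G" "h \<in> carrier G" "z = snd X g x" "w = snd X h x"
      by (auto simp: orbit_def)
    with eq show "z = w" using stab assms by (simp add: f gset_act_eq_iff)
  qed
  moreover have "f ` orbit G (snd X) x = orbit G (snd Y) y"
    unfolding orbit_def using f by (auto simp: image_iff) metis
  moreover have "f (snd X g z) = snd Y g (f z)"
    if "g \<in> carrier G" "z \<in> orbit G (snd X) x" for g z
  proof -
    obtain h where "h \<in> carrier G" "z = snd X h x" using \<open>z \<in> _\<close> by (auto simp: orbit_def)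
    then show ?thesis
      using that assms by (simp add: f gset_act_mult[OF X, symmetric])
        (simp add: f gset_act_mult[OF Y])
  qed
  ultimately show ?thesis
    unfolding gset_iso_def gset_on_def by (intro exI[of _ f]) (auto simp: bij_betw_def)
qed

section \<open>Coset spaces and their fixed points\<close>

lemma conj_subgroup_iff:
  assumes "K \<subseteq> carrier G" "a \<in> carrier G"
  shows "x \<in> conj_subgroup G a K \<longleftrightarrow> x \<in> carrier G \<and> inv a \<otimes> x \<otimes> a \<in> K"
proof
  assume "x \<in> conj_subgroup G a K"
  then obtain k where k: "k \<in> K" "x = a \<otimes> k \<otimes> inv a"
    by (auto simp: conj_subgroup_def l_coset_def r_coset_def)
  moreover have "inv a \<otimes> (a \<otimes> k \<otimes> inv a) \<otimes> a = k"
    using k assms by (simp add: m_assoc subset_iff) (simp add: m_assoc[symmetric] subset_iff)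
  ultimately show "x \<in> carrier G \<and> inv a \<otimes> x \<otimes> a \<in> K"
    using assms by auto
next
  assume x: "x \<in> carrier G \<and> inv a \<otimes> x \<otimes> a \<in> K"
  then have "x = a \<otimes> (inv a \<otimes> x \<otimes> a) \<otimes> inv a"
    using assms by (simp add: m_assoc) (simp add: m_assoc[symmetric])
  then show "x \<in> conj_subgroup G a K"
    using x by (force simp: conj_subgroup_def l_coset_def r_coset_def)
qed

lemma lcoset_eq_iff:
  assumes "subgroup K G" "a \<in> carrier G" "b \<in> carrier G"
  shows "a <# K = b <# K \<longleftrightarrow> inv b \<otimes> a \<in> K"
proof
  assume "a <# K = b <# K"
  then have "a \<in> b <# K" using lcos_self assms by blast
  then show "inv b \<otimes> a \<in> K"
    using subgroup.lcos_module_imp[OF assms(1) G] assms by blast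
next
  assume "inv b \<otimes> a \<in> K"
  then have "a \<in> b <# K"
    using subgroup.lcos_module_rev[OF assms(1) G] assms by blast
  then show "a <# K = b <# K" using l_repr_independence assms by metis
qed

lemma lcosetsE:
  assumes "C \<in> lcosets K"
  obtains a where "a \<in> carrier G" "C = a <# K"
  using assms by (auto simp: LCOSETS_def)

lemma lcosets_iff: "C \<in> lcosets K \<longleftrightarrow> (\<exists>a\<in>carrier G. C = a <# K)"
  by (auto simp: LCOSETS_def)

context
  fixes K
  assumes K: "subgroup K G"
begin

lemma lcos_mult: "g \<in> carrier G \<Longrightarrow> a \<in> carrier G \<Longrightarrow> g <# (a <# K) = (g \<otimes> a) <# K"
  using lcos_m_assoc subgroup.subset[OF K] by blast

lemma lcosets_closed: "g \<in> carrier G \<Longrightarrow> C \<in> lcosets K \<Longrightarrow> g <# C \<in> lcosets K"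
  by (auto simp: lcosets_iff lcos_mult)

lemma subgroup_in_lcosets: "K \<in> lcosets K"
  using lcos_mult_one[OF subgroup.subset[OF K]] by (force simp: lcosets_iff)

lemma finite_coset_gset:
  assumes "finite (carrier G)"
  shows "finite_gset G (coset_gset G K)"
  unfolding finite_gset_def coset_gset_def fst_conv snd_conv
proof
  show "group_action G (lcosets K) (\<lambda>g. \<lambda>C\<in>lcosets K. g <# C)"
  proof (rule group_actionI)
    fix g h x assume "g \<in> carrier G" "h \<in> carrier G" "x \<in> lcosets K"
    then show "(\<lambda>C\<in>lcosets K. (g \<otimes> h) <# C) x = (\<lambda>C\<in>lcosets K. g <# C) ((\<lambda>C\<in>lcosets K. h <# C) x)"
      by (auto simp: lcosets_closed lcosets_iff lcos_mult m_assoc)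
  next
    fix x assume x: "x \<in> lcosets K"
    then obtain a where "a \<in> carrier G" "x = a <# K" by (auto simp: lcosets_iff)
    with x show "(\<lambda>C\<in>lcosets K. \<one> <# C) x = x" by (simp add: lcos_mult)
  qed (auto simp: G lcosets_closed)
  show "finite (lcosets K)"
    using assms by (simp add: LCOSETS_def)
qed

lemma coset_stabilizer:
  assumes a: "a \<in> carrier G"
  shows "stabilizer G (snd (coset_gset G K)) (a <# K) = conj_subgroup G a K"
proof -
  have "a <# K \<in> lcosets K" using a by (auto simp: lcosets_iff)
  moreover have "g <# (a <# K) = a <# K \<longleftrightarrow> inv a \<otimes> g \<otimes> a \<in> K" if "g \<in> carrier G" for g
    using a that by (simp add: lcos_mult lcoset_eq_iff[OF K] m_assoc)
  ultimately show ?thesis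
    using a by (intro Set.set_eqI)
      (auto simp: stabilizer_def coset_gset_def conj_subgroup_iff subgroup.subset[OF K])
qed

lemma coset_stabilizer_self: "stabilizer G (snd (coset_gset G K)) K = K"
proof -
  have "conj_subgroup G \<one> K = K"
    using subgroup.mem_carrier[OF K] by (auto simp: conj_subgroup_iff[OF subgroup.subset[OF K]])
  then show ?thesis
    using coset_stabilizer[of \<one>] lcos_mult_one[OF subgroup.subset[OF K]] by simp
qed

lemma coset_orbit: "orbit G (snd (coset_gset G K)) K = lcosets K"
  using subgroup_in_lcosets by (auto simp: orbit_def coset_gset_def lcosets_iff)

text \<open>The action in \<open>coset_gset\<close> is already extensional on all cosets, so
  restricting to its single orbit gives the same pair, not just an isomorphic one.\<close>

lemma coset_gset_on_orbit: "gset_on (coset_gset G K) (lcosets K) = coset_gset G K"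
  by (simp add: gset_on_def coset_gset_def)

text \<open>The cosets fixed by \<open>L\<close> partition the set of \<open>g\<close> with \<open>g\<inverse> L g \<subseteq> K\<close>.\<close>
lemma card_fixed_points_coset:
  assumes "finite (carrier G)" "L \<subseteq> carrier G"
  shows "card K * card (fixed_points (coset_gset G K) L) =
    card {g \<in> carrier G. L \<subseteq> conj_subgroup G g K}"
proof -
  let ?F = "fixed_points (coset_gset G K) L"
  have F: "?F \<subseteq> lcosets K"
    by (auto simp: fixed_points_def coset_gset_def)
  have F_iff: "a <# K \<in> ?F \<longleftrightarrow> L \<subseteq> conj_subgroup G a K" if "a \<in> carrier G" for a
    using that assms mem_fixed_points_iff[OF finite_coset_gset[OF assms(1)]]
    by (auto simp: coset_stabilizer lcosets_iff) (auto simp: coset_gset_def lcosets_iff)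
  \<comment> \<open>Whether \<open>L\<close> lies in the conjugate of \<open>K\<close> by
    \<open>g\<close> depends only on the coset of \<open>g\<close>, so each coset qualifies entirely
    or not at all.\<close>
  have Un: "\<Union>?F = {g \<in> carrier G. L \<subseteq> conj_subgroup G g K}"
  proof (intro subset_antisym subsetI)
    fix g assume "g \<in> \<Union>?F"
    then obtain C where C: "C \<in> ?F" "g \<in> C" by blast
    then obtain a where a: "a \<in> carrier G" "C = a <# K" using F by (blast elim: lcosetsE)
    with C have "a <# K = g <# K" using l_repr_independence K by blast
    moreover have "g \<in> carrier G" using a C subgroup.elemlcos_carrier[OF K G] by blast
    ultimately show "g \<in> {g \<in> carrier G. L \<subseteq> conj_subgroup G g K}"
      using C a F_iff by auto
  next
    fix g assume "g \<in> {g \<in> carrier G. L \<subseteq> conj_subgroup G g K}"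
    then show "g \<in> \<Union>?F" using F_iff lcos_self[OF _ K] by blast
  qed
  have "card K * card ?F = card (\<Union>?F)"
  proof (rule card_partition)
    show "finite ?F" using F assms(1) finite_subset by (fastforce simp: LCOSETS_def)
    show "finite (\<Union>?F)" unfolding Un using assms(1) by simp
    show "card C = card K" if "C \<in> ?F" for C
    proof -
      obtain a where a: "a \<in> carrier G" "C = a <# K" using F \<open>C \<in> ?F\<close> by (blast elim: lcosetsE)
      have "C = (\<lambda>k. a \<otimes> k) ` K" unfolding a by (auto simp: l_coset_def)
      moreover have "inj_on (\<lambda>k. a \<otimes> k) K"
        using a subgroup.subset[OF K] by (auto simp: inj_on_def subset_iff)
      ultimately show ?thesis by (simp add: card_image)
    qed
    show "C \<inter> D = {}" if CD: "C \<in> ?F" "D \<in> ?F" "C \<noteq> D" for C D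
      using lcos_disjoint[OF K, of C D] F CD by (auto dest: subsetD)
  qed
  with Un show ?thesis by simp
qed

end

end


section \<open>Burnside's theorem for admissible G-sets\<close>

locale transfer_group = group G for G :: "('a, 'm) monoid_scheme" (structure) +
  fixes \<O> :: "('a set \<times> 'a set) set"
  assumes finite_carrier: "finite (carrier G)"
    and transfer_system: "transfer_system G \<O>"
begin

abbreviation adm :: "'a set set" where
  "adm \<equiv> admissible_subgroups G \<O>"

lemma transfer_subgroup:
  assumes "(K, H) \<in> \<O>"
  shows "subgroup K G" "subgroup H G"
  using transfer_system assms
  by (auto simp: transfer_system_def partial_order_on_def preorder_on_def)

lemma transfer_refl: "subgroup H G \<Longrightarrow> (H, H) \<in> \<O>"
  using transfer_system
  by (auto simp: transfer_system_def partial_order_on_def preorder_on_def refl_on_def)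

lemma transfer_trans: "(K, H) \<in> \<O> \<Longrightarrow> (H, L) \<in> \<O> \<Longrightarrow> (K, L) \<in> \<O>"
  using transfer_system
  by (auto simp: transfer_system_def partial_order_on_def preorder_on_def dest: transD)

lemma transfer_subset: "(K, H) \<in> \<O> \<Longrightarrow> K \<subseteq> H"
  using transfer_system by (simp add: transfer_system_def)

lemma transfer_conj:
  "(K, H) \<in> \<O> \<Longrightarrow> g \<in> carrier G \<Longrightarrow> (conj_subgroup G g K, conj_subgroup G g H) \<in> \<O>"
  using transfer_system by (simp add: transfer_system_def)

lemma transfer_restrict: "(K, H) \<in> \<O> \<Longrightarrow> subgroup L G \<Longrightarrow> L \<subseteq> H \<Longrightarrow> (K \<inter> L, L) \<in> \<O>"
  using transfer_system by (simp add: transfer_system_def)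

lemma admD: "K \<in> adm \<Longrightarrow> subgroup K G" "K \<in> adm \<Longrightarrow> K \<subseteq> carrier G"
  by (auto simp: admissible_subgroups_def transfer_subgroup dest: transfer_subset)

lemma transfer_adm: "(K, H) \<in> \<O> \<Longrightarrow> H \<in> adm \<Longrightarrow> K \<in> adm"
  by (auto simp: admissible_subgroups_def intro: transfer_trans)

lemma finite_adm: "finite adm"
  by (rule finite_subset[of _ "Pow (carrier G)"]) (auto simp: finite_carrier dest: admD(2))

text \<open>Restricting the transfer from \<open>M\<close> to the whole group along \<open>K\<close>
  gives \<open>(M \<inter> K, K)\<close>, and \<open>M \<inter> K = M\<close>. This is the only
  point where an inclusion is upgraded to a transfer.\<close>

lemma adm_transfer: "M \<in> adm \<Longrightarrow> subgroup K G \<Longrightarrow> M \<subseteq> K \<Longrightarrow> (M, K) \<in> \<O>"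
  using transfer_restrict[of M "carrier G" K]
  by (auto simp: admissible_subgroups_def Int_absorb2 subgroup.subset)

text \<open>Conjugation preserves transfers and fixes the whole group.\<close>

lemma adm_conj:
  assumes "K \<in> adm" "g \<in> carrier G"
  shows "conj_subgroup G g K \<in> adm"
proof -
  have "conj_subgroup G g (carrier G) = carrier G"
    using assms(2) by (auto simp: conj_subgroup_iff[OF is_group])
  then show ?thesis
    using transfer_conj[of K "carrier G" g] assms by (simp add: admissible_subgroups_def)
qed

text \<open>An orbit isomorphic to G/K has conjugates of K as stabilizers, and \<open>adm\<close> is
  closed under conjugation; conversely an orbit is G modulo any of its stabilizers. The pointwise
  form passes easily to invariant subsets, sums and isomorphic copies.\<close>

lemma admissible_gset_iff:
  assumes X: "finite_gset G X"
  shows "admissible_gset G \<O> X \<longleftrightarrow> (\<forall>x\<in>fst X. stabilizer G (snd X) x \<in> adm)"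
proof (intro iffI ballI)
  fix x assume adm: "admissible_gset G \<O> X" and x: "x \<in> fst X"
  let ?B = "orbit G (snd X) x"
  have "?B \<in> orbits G (fst X) (snd X)" using x by (auto simp: orbits_def)
  then obtain K where K: "K \<in> adm" and iso: "gset_iso G (gset_on X ?B) (coset_gset G K)"
    using adm unfolding admissible_gset_def gset_on_def by blast
  obtain f where f: "bij_betw f (fst (gset_on X ?B)) (fst (coset_gset G K))"
    "\<forall>g\<in>carrier G. \<forall>x\<in>fst (gset_on X ?B). f (snd (gset_on X ?B) g x) = snd (coset_gset G K) g (f x)"
    using iso unfolding gset_iso_def by blast
  have xB: "x \<in> fst (gset_on X ?B)"
    using gset_orbit_refl[OF is_group X x] by (simp add: gset_on_def)
  have fin: "finite_gset G (gset_on X ?B)"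
    using finite_gset_on[OF is_group X gset_orbit_subset[OF is_group X x]]
      gset_orbit_closed[OF is_group X x] by blast
  have "f x \<in> lcosets K"
    using bij_betw_apply[OF f(1) xB] by (simp add: coset_gset_def)
  then obtain a where a: "a \<in> carrier G" "f x = a <# K" by (rule lcosetsE[OF is_group])
  have "stabilizer G (snd X) x = stabilizer G (snd (coset_gset G K)) (f x)"
    using iso_stabilizer[OF is_group fin f(1) _ xB] f(2)
      stabilizer_gset_on[OF is_group X, of x ?B] xB by (simp add: gset_on_def)
  also have "\<dots> = conj_subgroup G a K"
    using a by (simp add: coset_stabilizer[OF is_group] admD[OF K])
  finally show "stabilizer G (snd X) x \<in> adm" using adm_conj[OF K a(1)] by simp
next
  assume stab: "\<forall>x\<in>fst X. stabilizer G (snd X) x \<in> adm"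
  show "admissible_gset G \<O> X"
    unfolding admissible_gset_def
  proof
    fix B assume "B \<in> orbits G (fst X) (snd X)"
    then obtain x where x: "x \<in> fst X" "B = orbit G (snd X) x" by (auto simp: orbits_def)
    define K where "K = stabilizer G (snd X) x"
    have K: "K \<in> adm" using stab x by (simp add: K_def)
    note sub = admD(1)[OF K]
    have "gset_iso G (gset_on X B) (gset_on (coset_gset G K) (orbit G (snd (coset_gset G K)) K))"
      unfolding x(2)
    proof (rule orbit_iso[OF is_group X finite_coset_gset[OF is_group sub finite_carrier] x(1)])
      show "K \<in> fst (coset_gset G K)"
        using subgroup_in_lcosets[OF is_group sub] by (simp add: coset_gset_def)
      show "stabilizer G (snd X) x = stabilizer G (snd (coset_gset G K)) K"
        unfolding coset_stabilizer_self[OF is_group sub] by (simp add: K_def)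
    qed
    then show "\<exists>K\<in>adm. gset_iso G (B, \<lambda>g. restrict (snd X g) B) (coset_gset G K)"
      using K unfolding coset_orbit[OF is_group sub] coset_gset_on_orbit[OF is_group sub]
      by (auto simp: gset_on_def)
  qed
qed

lemma admissible_coset_gset:
  assumes K: "K \<in> adm"
  shows "admissible_gset G \<O> (coset_gset G K)"
proof -
  have "stabilizer G (snd (coset_gset G K)) C \<in> adm" if C: "C \<in> lcosets K" for C
    using C
  proof (rule lcosetsE[OF is_group])
    fix a assume "a \<in> carrier G" "C = a <# K"
    then show ?thesis
      using coset_stabilizer[OF is_group admD(1)[OF K]] adm_conj[OF K] by simp
  qed
  then show ?thesis
    by (subst admissible_gset_iff[OF finite_coset_gset[OF is_group admD(1)[OF K] finite_carrier]])
      (simp add: coset_gset_def)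
qed

lemma admissible_gset_iso:
  assumes X: "finite_gset G X" and Y: "finite_gset G Y" and iso: "gset_iso G X Y"
    and adm: "admissible_gset G \<O> X"
  shows "admissible_gset G \<O> Y"
  unfolding admissible_gset_iff[OF Y]
proof
  fix y assume y: "y \<in> fst Y"
  obtain f where f: "bij_betw f (fst X) (fst Y)"
    "\<forall>g\<in>carrier G. \<forall>x\<in>fst X. f (snd X g x) = snd Y g (f x)"
    using iso unfolding gset_iso_def by blast
  have "y \<in> f ` fst X" using y bij_betw_imp_surj_on[OF f(1)] by simp
  then obtain x where x: "x \<in> fst X" "y = f x" by blast
  then have "stabilizer G (snd Y) y = stabilizer G (snd X) x"
    using iso_stabilizer[OF is_group X f(1) _ x(1)] f(2) by simp
  then show "stabilizer G (snd Y) y \<in> adm"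
    using adm x(1) admissible_gset_iff[OF X] by simp
qed

lemma admissible_gset_sum:
  assumes "finite_gset G X" "finite_gset G Y" "admissible_gset G \<O> X" "admissible_gset G \<O> Y"
  shows "admissible_gset G \<O> (gset_sum X Y)"
proof -
  have "stabilizer G (snd (gset_sum X Y)) (Inl x) = stabilizer G (snd X) x" if "x \<in> fst X" for x
    using that by (simp add: stabilizer_def gset_sum_def InlI)
  moreover have "stabilizer G (snd (gset_sum X Y)) (Inr y) = stabilizer G (snd Y) y" if "y \<in> fst Y" for y
    using that by (simp add: stabilizer_def gset_sum_def InrI)
  moreover have "fst (gset_sum X Y) = fst X <+> fst Y" by (simp add: gset_sum_def)
  ultimately show ?thesis
    using assms(3,4) admissible_gset_iff[OF assms(1)] admissible_gset_iff[OF assms(2)]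
    unfolding admissible_gset_iff[OF finite_gset_sum[OF is_group assms(1,2)]]
    by (auto elim!: PlusE)
qed

lemma admissible_gset_empty: "admissible_gset G \<O> gset_empty"
  by (simp add: admissible_gset_def orbits_def gset_empty_def)

text \<open>Burnside's theorem: a point whose stabilizer has maximal order has, up to isomorphism, the
  same orbit in both sets, and this orbit can be split off.\<close>
theorem marks_determine_gset:
  assumes "finite_gset G X" "finite_gset G Y" "admissible_gset G \<O> X" "admissible_gset G \<O> Y"
    and "\<And>K. K \<in> adm \<Longrightarrow> card (fixed_points X K) = card (fixed_points Y K)"
  shows "gset_iso G X Y"
  using assms
proof (induction "card (fst X)" arbitrary: X Y rule: less_induct)
  case less
  note X = less.prems(1) and Y = less.prems(2) and marks = less.prems(5)
  note finX = gset_finite[OF is_group X] and finY = gset_finite[OF is_group Y]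
  have stabX: "stabilizer G (snd X) x \<in> adm" if "x \<in> fst X" for x
    using less.prems(3) that admissible_gset_iff[OF X] by blast
  have stabY: "stabilizer G (snd Y) y \<in> adm" if "y \<in> fst Y" for y
    using less.prems(4) that admissible_gset_iff[OF Y] by blast
  have fixX: "x \<in> fixed_points X K \<longleftrightarrow> x \<in> fst X \<and> K \<subseteq> stabilizer G (snd X) x" if "K \<in> adm" for x K
    using mem_fixed_points_iff[OF is_group X admD(2)[OF that]] .
  have fixY: "x \<in> fixed_points Y K \<longleftrightarrow> x \<in> fst Y \<and> K \<subseteq> stabilizer G (snd Y) x" if "K \<in> adm" for x K
    using mem_fixed_points_iff[OF is_group Y admD(2)[OF that]] .
  have fin_fix: "finite (fixed_points X K)" "finite (fixed_points Y K)" for K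
    using finX finY by (auto simp: fixed_points_def)
  \<comment> \<open>Only the vanishing of marks is used here: if \<open>K\<close> fixes a point of
    \<open>X\<close>, the common mark at \<open>K\<close> is nonzero, so \<open>K\<close> fixes a
    point of \<open>Y\<close>.\<close>
  have XtoY: "\<exists>y\<in>fst Y. K \<subseteq> stabilizer G (snd Y) y" if "x \<in> fst X" "K \<in> adm" "K \<subseteq> stabilizer G (snd X) x" for K x
  proof -
    have "fixed_points X K \<noteq> {}" using fixX that by blast
    then have "fixed_points Y K \<noteq> {}"
      using marks[OF that(2)] fin_fix by (metis card_0_eq)
    then show ?thesis using fixY[OF that(2)] by blast
  qed
  have YtoX: "\<exists>y\<in>fst X. K \<subseteq> stabilizer G (snd X) y" if "x \<in> fst Y" "K \<in> adm" "K \<subseteq> stabilizer G (snd Y) x" for K x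
  proof -
    have "fixed_points Y K \<noteq> {}" using fixY that by blast
    then have "fixed_points X K \<noteq> {}"
      using marks[OF that(2)] fin_fix by (metis card_0_eq)
    then show ?thesis using fixX[OF that(2)] by blast
  qed
  show ?case
  proof (cases "fst X = {}")
    case True
    then have "fst Y = {}" using YtoX stabY by blast
    with True show ?thesis by (simp add: gset_iso_def bij_betw_def)
  next
    case False
    let ?s = "\<lambda>x. card (stabilizer G (snd X) x)"
    \<comment> \<open>Maximal order replaces maximality up to conjugation: it makes the inclusions
      of stabilizers found by going from \<open>X\<close> to \<open>Y\<close> and back collapse to
      equalities.\<close>
    obtain x where x: "x \<in> fst X" and max: "\<And>z. z \<in> fst X \<Longrightarrow> ?s z \<le> ?s x"
    proof -
      have "Max (?s ` fst X) \<in> ?s ` fst X" using False finX by (intro Max_in) auto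
      then obtain x where "x \<in> fst X" "Max (?s ` fst X) = ?s x" by blast
      then show ?thesis using finX by (intro that[of x]) (metis Max_ge finite_imageI imageI)+
    qed
    obtain y where y: "y \<in> fst Y" and xy: "stabilizer G (snd X) x \<subseteq> stabilizer G (snd Y) y"
      using XtoY[OF x stabX[OF x] order_refl] by blast
    obtain z where z: "z \<in> fst X" and yz: "stabilizer G (snd Y) y \<subseteq> stabilizer G (snd X) z"
      using YtoX[OF y stabY[OF y] order_refl] by blast
    have "finite (stabilizer G (snd X) z)"
      using admD(2)[OF stabX[OF z]] finite_carrier finite_subset by blast
    then have "stabilizer G (snd X) x = stabilizer G (snd X) z"
      using card_seteq[of "stabilizer G (snd X) z" "stabilizer G (snd X) x"] xy yz max[OF z] by auto
    then have stab: "stabilizer G (snd X) x = stabilizer G (snd Y) y" using xy yz by blast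
    define S where "S = orbit G (snd X) x"
    define T where "T = orbit G (snd Y) y"
    have S: "S \<subseteq> fst X" "x \<in> S" and T: "T \<subseteq> fst Y"
      using gset_orbit_subset[OF is_group X x] gset_orbit_refl[OF is_group X x]
        gset_orbit_subset[OF is_group Y y] by (auto simp: S_def T_def)
    have closed: "\<And>g z. g \<in> carrier G \<Longrightarrow> z \<in> S \<Longrightarrow> snd X g z \<in> S"
      "\<And>g z. g \<in> carrier G \<Longrightarrow> z \<in> fst X - S \<Longrightarrow> snd X g z \<in> fst X - S"
      "\<And>g z. g \<in> carrier G \<Longrightarrow> z \<in> fst Y - T \<Longrightarrow> snd Y g z \<in> fst Y - T"
      using gset_orbit_closed[OF is_group X x] gset_orbit_compl_closed[OF is_group X x]
        gset_orbit_compl_closed[OF is_group Y y] by (simp_all only: S_def T_def)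
    have finS: "finite_gset G (gset_on X S)"
      by (rule finite_gset_on[OF is_group X S(1) closed(1)])
    have isoST: "gset_iso G (gset_on X S) (gset_on Y T)"
      unfolding S_def T_def by (rule orbit_iso[OF is_group X Y x y stab])
    have fX': "finite_gset G (gset_on X (fst X - S))"
      by (rule finite_gset_on[OF is_group X Diff_subset closed(2)])
    have fY': "finite_gset G (gset_on Y (fst Y - T))"
      by (rule finite_gset_on[OF is_group Y Diff_subset closed(3)])
    have "gset_iso G (gset_on X (fst X - S)) (gset_on Y (fst Y - T))"
    proof (rule less.hyps[OF _ fX' fY'])
      have "fst X - S \<subset> fst X" using S by blast
      then show "card (fst (gset_on X (fst X - S))) < card (fst X)"
        using finX by (simp add: gset_on_def psubset_card_mono)
      show "admissible_gset G \<O> (gset_on X (fst X - S))"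
        unfolding admissible_gset_iff[OF fX'] using stabX by (simp add: stabilizer_def gset_on_def)
      show "admissible_gset G \<O> (gset_on Y (fst Y - T))"
        unfolding admissible_gset_iff[OF fY'] using stabY by (simp add: stabilizer_def gset_on_def)
      fix K assume K: "K \<in> adm"
      \<comment> \<open>The removed orbits are isomorphic and hence have equal marks; subtracting
        them leaves equal marks on the complements, as the induction hypothesis requires.\<close>
      have "card (fixed_points X K \<inter> S) = card (fixed_points Y K \<inter> T)"
        using card_fixed_points_iso[OF isoST admD(2)[OF K]] gset_act_closed[OF is_group finS]
        by (simp add: fixed_points_gset_on S(1) T)
      moreover have "card (fixed_points X K) = card (fixed_points X K \<inter> S) + card (fixed_points X K - S)"
        using card_Int_Diff[OF fin_fix(1)] .
      moreover have "card (fixed_points Y K) = card (fixed_points Y K \<inter> T) + card (fixed_points Y K - T)"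
        using card_Int_Diff[OF fin_fix(2)] .
      moreover have "fixed_points X K \<inter> (fst X - S) = fixed_points X K - S"
        "fixed_points Y K \<inter> (fst Y - T) = fixed_points Y K - T"
        by (auto simp: fixed_points_def)
      ultimately show "card (fixed_points (gset_on X (fst X - S)) K) =
          card (fixed_points (gset_on Y (fst Y - T)) K)"
        using marks[OF K] by (simp add: fixed_points_gset_on)
    qed
    then show ?thesis
      by (rule gset_iso_glue[where S = S and T = T, rotated 5])
        (use S(1) T closed isoST in auto)
  qed
qed

section \<open>Isomorphism classes and the monoid they form\<close>

lemma gset_class_eqI:
  assumes "finite_gset G X" "gset_iso G X Y"
  shows "gset_class G X = gset_class G Y"
proof -
  have "gset_iso G X Z \<longleftrightarrow> gset_iso G Y Z" for Z :: "('a, nat) gset"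
    using gset_iso_trans[OF assms(2), of Z] gset_iso_trans[OF gset_iso_sym[OF is_group assms], of Z]
    by blast
  then show ?thesis by (simp add: gset_class_def)
qed

lemma gset_class_self: "finite_gset G X \<Longrightarrow> X \<in> gset_class G X"
  by (simp add: gset_class_def gset_iso_refl)

lemma ex_gset_class:
  assumes "finite_gset G X"
  shows "\<exists>Y. Y \<in> gset_class G X"
  using ex_nat_gset[OF is_group assms] by (auto simp: gset_class_def)

text \<open>Isomorphic G-sets have equal marks, and the class is nonempty because \<open>X\<close>
  has a copy on natural numbers; so \<open>the_elem\<close> meets a genuine singleton.\<close>

lemma class_mark_gset_class:
  assumes "finite_gset G X" "K \<subseteq> carrier G"
  shows "class_mark K (gset_class G X) = of_nat (card (fixed_points X K))"
proof -
  have "card (fixed_points Y K) = card (fixed_points X K)" if "Y \<in> gset_class G X" for Y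
    using that card_fixed_points_iso[of G X Y K] assms gset_act_closed[OF is_group assms(1)]
    by (simp add: gset_class_def)
  then have "(\<lambda>Y. rat_of_nat (card (fixed_points Y K))) ` gset_class G X =
      {of_nat (card (fixed_points X K))}"
    using ex_gset_class[OF assms(1)] by (auto simp: image_iff)
  then show ?thesis by (simp add: class_mark_def)
qed

text \<open>The carrier is indexed by G-sets on natural numbers, so a G-set over another type, such
  as a coset space, is first replaced by a copy.\<close>

lemma gset_class_closed:
  assumes "finite_gset G X" "admissible_gset G \<O> X"
  shows "gset_class G X \<in> carrier (gset_semiring G \<O>)"
proof -
  obtain Y :: "('a, nat) gset" where Y: "finite_gset G Y" "gset_iso G X Y"
    using ex_nat_gset[OF is_group assms(1)] by blast
  then have "gset_class G X = gset_class G Y" "admissible_gset G \<O> Y"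
    using assms gset_class_eqI admissible_gset_iso by blast+
  then show ?thesis using Y by (simp add: gset_semiring_def)
qed

lemma gset_semiringE:
  assumes "C \<in> carrier (gset_semiring G \<O>)"
  obtains X :: "('a, nat) gset" where "finite_gset G X" "admissible_gset G \<O> X" "C = gset_class G X"
  using assms by (auto simp: gset_semiring_def)

lemma gset_class_add:
  fixes X Y :: "('a, nat) gset"
  assumes "finite_gset G X" "finite_gset G Y"
  shows "gset_class G X \<oplus>\<^bsub>gset_semiring G \<O>\<^esub> gset_class G Y = gset_class G (gset_sum X Y)"
proof -
  have "gset_class G (gset_sum X' Y') = gset_class G (gset_sum X Y)"
    if "X' \<in> gset_class G X" "Y' \<in> gset_class G Y" for X' Y'
    using that gset_class_eqI[OF finite_gset_sum[OF is_group assms] gset_iso_gset_sum[of G X X' Y Y']]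
    by (simp add: gset_class_def)
  then have "(\<Union>X'\<in>gset_class G X. \<Union>Y'\<in>gset_class G Y. gset_class G (gset_sum X' Y')) =
      gset_class G (gset_sum X Y)"
    using gset_class_self[OF assms(1)] gset_class_self[OF assms(2)] by blast
  then show ?thesis by (simp add: gset_semiring_def)
qed

text \<open>Base of the tower: separation is Burnside's theorem, additivity is the splitting of
  fixed points over a disjoint union.\<close>

lemma separated_gset_semiring: "separated_monoid (gset_semiring G \<O>) adm class_mark"
proof
  have zero: "\<zero>\<^bsub>gset_semiring G \<O>\<^esub> = gset_class G gset_empty"
    by (simp add: gset_semiring_def)
  show "\<zero>\<^bsub>gset_semiring G \<O>\<^esub> \<in> carrier (gset_semiring G \<O>)"
    unfolding zero
    by (rule gset_class_closed[OF finite_gset_empty[OF is_group] admissible_gset_empty])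
  show "class_mark K \<zero>\<^bsub>gset_semiring G \<O>\<^esub> = 0" if "K \<in> adm" for K
    unfolding zero class_mark_gset_class[OF finite_gset_empty[OF is_group] admD(2)[OF that]]
    by (simp add: fixed_points_def gset_empty_def)
  fix C D assume CD: "C \<in> carrier (gset_semiring G \<O>)" "D \<in> carrier (gset_semiring G \<O>)"
  obtain X :: "('a, nat) gset" where X: "finite_gset G X" "admissible_gset G \<O> X" "C = gset_class G X"
    using CD(1) by (rule gset_semiringE)
  obtain Y :: "('a, nat) gset" where Y: "finite_gset G Y" "admissible_gset G \<O> Y" "D = gset_class G Y"
    using CD(2) by (rule gset_semiringE)
  note sum = finite_gset_sum[OF is_group X(1) Y(1)] admissible_gset_sum[OF X(1) Y(1) X(2) Y(2)]
  show "C \<oplus>\<^bsub>gset_semiring G \<O>\<^esub> D \<in> carrier (gset_semiring G \<O>)"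
    unfolding X(3) Y(3) gset_class_add[OF X(1) Y(1)] by (rule gset_class_closed[OF sum])
  show "class_mark K (C \<oplus>\<^bsub>gset_semiring G \<O>\<^esub> D) = class_mark K C + class_mark K D" if "K \<in> adm" for K
  proof -
    have "finite (fixed_points X K)" "finite (fixed_points Y K)"
      using gset_finite[OF is_group X(1)] gset_finite[OF is_group Y(1)] by (auto simp: fixed_points_def)
    then show ?thesis
      using X(1) Y(1) sum(1) admD(2)[OF that] unfolding X(3) Y(3)
      by (simp add: gset_class_add class_mark_gset_class fixed_points_gset_sum card_Plus)
  qed
  show "C = D" if "\<And>K. K \<in> adm \<Longrightarrow> class_mark K C = class_mark K D"
    unfolding X(3) Y(3)
  proof (rule gset_class_eqI[OF X(1)])
    show "gset_iso G X Y"
      by (rule marks_determine_gset[OF X(1) Y(1) X(2) Y(2)])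
        (use that X Y in \<open>simp add: class_mark_gset_class admD\<close>)
  qed
qed

end


section \<open>Moebius inversion and the marks of the idempotent\<close>

lemma transfer_chains_0: "transfer_chains \<O> 0 K H = (if K = H then {[K]} else {})"
  by (auto simp: transfer_chains_def length_Suc_conv)

text \<open>Chains are peeled at the bottom with the top \<open>H\<close> kept fixed, because the
  recursion \<open>mobius_rec\<close> varies the lower argument.\<close>

lemma transfer_chains_Suc:
  "transfer_chains \<O> (Suc i) K H =
     (\<Union>L\<in>{L. (K, L) \<in> \<O> \<and> K \<subset> L}. (#) K ` transfer_chains \<O> i L H)" (is "?A = ?B")
proof (intro subset_antisym subsetI)
  fix Hs assume "Hs \<in> ?A"
  then have Hs: "length Hs = Suc (Suc i)" "Hs ! 0 = K" "Hs ! Suc i = H"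
    "\<And>j. j < Suc i \<Longrightarrow> (Hs ! j, Hs ! Suc j) \<in> \<O> \<and> Hs ! j \<subset> Hs ! Suc j"
    by (auto simp: transfer_chains_def)
  from Hs(1) obtain K' Ls where Ls: "Hs = K' # Ls" "length Ls = Suc i"
    by (auto simp: length_Suc_conv)
  have "(K, Ls ! 0) \<in> \<O> \<and> K \<subset> Ls ! 0"
    using Hs(4)[of 0] Hs(2) Ls by simp
  moreover have "Ls \<in> transfer_chains \<O> i (Ls ! 0) H"
    using Hs(3) Hs(4)[of "Suc j" for j] Ls by (simp add: transfer_chains_def)
  ultimately show "Hs \<in> ?B" using Ls Hs(2) by auto
next
  fix Hs assume "Hs \<in> ?B"
  then obtain L Ls where L: "(K, L) \<in> \<O>" "K \<subset> L" "Ls \<in> transfer_chains \<O> i L H" "Hs = K # Ls"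
    by blast
  have "(Hs ! j, Hs ! Suc j) \<in> \<O> \<and> Hs ! j \<subset> Hs ! Suc j" if "j < Suc i" for j
    using that L by (cases j) (auto simp: transfer_chains_def)
  with L show "Hs \<in> ?A" by (simp add: transfer_chains_def)
qed

context transfer_group
begin

lemma finite_above: "finite {L. (K, L) \<in> \<O> \<and> P L}"
  by (rule finite_subset[of _ "Pow (carrier G)"])
    (auto simp: finite_carrier dest: transfer_subgroup subgroup.subset)

lemma finite_transfer_chains: "finite (transfer_chains \<O> i K H)"
  by (induction i arbitrary: K) (auto simp: transfer_chains_0 transfer_chains_Suc finite_above)

lemma transfer_chains_nonempty:
  assumes "transfer_chains \<O> i K H \<noteq> {}" "subgroup K G"
  shows "(K, H) \<in> \<O>"
  using assms
proof (induction i arbitrary: K)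
  case 0
  then show ?case by (auto simp: transfer_chains_0 transfer_refl split: if_splits)
next
  case (Suc i)
  then show ?case
    by (auto simp: transfer_chains_Suc dest: transfer_subgroup intro: transfer_trans)
qed

text \<open>Each strict step raises the order of the subgroup by at least one, and the top is
  contained in the group.\<close>

lemma transfer_chains_bound:
  assumes "transfer_chains \<O> i K H \<noteq> {}" "subgroup K G"
  shows "i + card K \<le> order G"
  using assms
proof (induction i arbitrary: K)
  case 0
  then show ?case
    by (simp add: order_def card_mono finite_carrier subgroup.subset)
next
  case (Suc i)
  then obtain L where L: "(K, L) \<in> \<O>" "K \<subset> L" "transfer_chains \<O> i L H \<noteq> {}"
    by (auto simp: transfer_chains_Suc)
  note sub = transfer_subgroup(2)[OF L(1)]
  have "finite L" using subgroup.subset[OF sub] finite_carrier finite_subset by blast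
  then have "card K < card L" using L(2) by (rule psubset_card_mono)
  with Suc.IH[OF L(3) sub] show ?case by simp
qed

text \<open>Lengths without chains contribute zero. A range of lengths common to all lower arguments
  is what allows the sums over lengths and over subgroups to be interchanged.\<close>

lemma mobius_eq_sum:
  assumes "subgroup K G" "order G \<le> n"
  shows "transfer_mobius \<O> K H = (\<Sum>i\<le>n. (- 1) ^ i * int (card (transfer_chains \<O> i K H)))"
  unfolding transfer_mobius_def
proof (rule sum.mono_neutral_left)
  show "{i. transfer_chains \<O> i K H \<noteq> {}} \<subseteq> {..n}"
  proof
    fix i assume "i \<in> {i. transfer_chains \<O> i K H \<noteq> {}}"
    then have "transfer_chains \<O> i K H \<noteq> {}" by simp
    from transfer_chains_bound[OF this assms(1)] show "i \<in> {..n}" using assms(2) by simp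
  qed
qed auto

lemma mobius_eq_0:
  assumes "subgroup K G" "(K, H) \<notin> \<O>"
  shows "transfer_mobius \<O> K H = 0"
proof -
  have "transfer_chains \<O> i K H = {}" for i
    using transfer_chains_nonempty[OF _ assms(1)] assms(2) by blast
  then show ?thesis by (simp add: transfer_mobius_def)
qed

text \<open>A nontrivial chain from \<open>K\<close> is determined by its second member
  \<open>L\<close> and the rest from \<open>L\<close> to \<open>H\<close>; dropping \<open>K\<close>
  shortens it by one and so flips the sign.\<close>

lemma mobius_rec:
  assumes K: "subgroup K G"
  shows "transfer_mobius \<O> K H =
    (if K = H then 1 else 0) - (\<Sum>L | (K, L) \<in> \<O> \<and> K \<subset> L. transfer_mobius \<O> L H)"
proof -
  let ?c = "\<lambda>i K. int (card (transfer_chains \<O> i K H))"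
  let ?U = "{L. (K, L) \<in> \<O> \<and> K \<subset> L}"
  have c_Suc: "?c (Suc i) K = (\<Sum>L\<in>?U. ?c i L)" for i
  proof -
    have "card (transfer_chains \<O> (Suc i) K H) = (\<Sum>L\<in>?U. card ((#) K ` transfer_chains \<O> i L H))"
      unfolding transfer_chains_Suc
    proof (rule card_UN_disjoint)
      show "\<forall>L\<in>?U. \<forall>M\<in>?U. L \<noteq> M \<longrightarrow>
          (#) K ` transfer_chains \<O> i L H \<inter> (#) K ` transfer_chains \<O> i M H = {}"
        by (auto simp: transfer_chains_def)
    qed (auto simp: finite_above finite_transfer_chains)
    then show ?thesis by (simp add: card_image)
  qed
  \<comment> \<open>One more length than necessary, so that after the trivial chains are split off
    the shifted index still runs up to \<open>order G\<close>, a full range for every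
    \<open>L\<close>.\<close>
  have "transfer_mobius \<O> K H = (\<Sum>i\<le>Suc (order G). (- 1) ^ i * ?c i K)"
    using K by (intro mobius_eq_sum) auto
  also have "\<dots> = ?c 0 K + (\<Sum>i\<le>order G. (- 1) ^ Suc i * ?c (Suc i) K)"
    by (subst sum.atMost_Suc_shift) simp
  also have "(\<Sum>i\<le>order G. (- 1) ^ Suc i * ?c (Suc i) K) =
      - (\<Sum>i\<le>order G. \<Sum>L\<in>?U. (- 1) ^ i * ?c i L)"
    unfolding c_Suc by (simp add: sum_negf sum_distrib_left)
  also have "(\<Sum>i\<le>order G. \<Sum>L\<in>?U. (- 1) ^ i * ?c i L) = (\<Sum>L\<in>?U. \<Sum>i\<le>order G. (- 1) ^ i * ?c i L)"
    by (rule sum.swap)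
  also have "\<dots> = (\<Sum>L\<in>?U. transfer_mobius \<O> L H)"
    by (rule sum.cong) (auto simp: mobius_eq_sum[OF _ order_refl] dest: transfer_subgroup(2))
  finally show ?thesis by (simp add: transfer_chains_0)
qed

text \<open>Moving the sum in \<open>mobius_rec\<close> to the left adds the term for
  \<open>L = K\<close>. Subgroups above \<open>K\<close> without a transfer to \<open>H\<close> can
  be included or dropped freely, since \<open>transfer_mobius\<close> vanishes there.\<close>

lemma sum_mobius:
  assumes "(K, H) \<in> \<O>"
  shows "(\<Sum>L | (K, L) \<in> \<O> \<and> (L, H) \<in> \<O>. transfer_mobius \<O> L H) = (if K = H then 1 else 0)"
proof -
  note K = transfer_subgroup(1)[OF assms]
  have fin: "finite {L. (K, L) \<in> \<O> \<and> K \<subset> L}" by (rule finite_above)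
  have "(\<Sum>L | (K, L) \<in> \<O> \<and> (L, H) \<in> \<O>. transfer_mobius \<O> L H) =
      (\<Sum>L | (K, L) \<in> \<O>. transfer_mobius \<O> L H)"
    by (rule sum.mono_neutral_left)
      (use finite_above[of K "\<lambda>_. True"] in \<open>auto intro: mobius_eq_0 dest: transfer_subgroup(2)\<close>)
  also have "{L. (K, L) \<in> \<O>} = insert K {L. (K, L) \<in> \<O> \<and> K \<subset> L}"
    using transfer_refl[OF K] transfer_subset by auto
  also have "(\<Sum>L\<in>\<dots>. transfer_mobius \<O> L H) =
      transfer_mobius \<O> K H + (\<Sum>L | (K, L) \<in> \<O> \<and> K \<subset> L. transfer_mobius \<O> L H)"
    using fin by simp
  also have "\<dots> = (if K = H then 1 else 0)"
    using mobius_rec[OF K, of H] by simp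
  finally show ?thesis .
qed

section \<open>Conjugation and the evaluation of the marks of the sum\<close>

lemma conj_subgroup_mult:
  assumes "K \<subseteq> carrier G" "g \<in> carrier G" "h \<in> carrier G"
  shows "conj_subgroup G (g \<otimes> h) K = conj_subgroup G g (conj_subgroup G h K)"
proof -
  have "conj_subgroup G h K \<subseteq> carrier G"
    using assms by (auto simp: conj_subgroup_iff[OF is_group])
  then show ?thesis
    using assms by (intro Set.set_eqI) (auto simp: conj_subgroup_iff[OF is_group] inv_mult_group m_assoc)
qed

lemma conj_subgroup_one: "K \<subseteq> carrier G \<Longrightarrow> conj_subgroup G \<one> K = K"
  by (intro Set.set_eqI) (auto simp: conj_subgroup_iff[OF is_group])

lemma conj_subgroup_mono: "K \<subseteq> L \<Longrightarrow> conj_subgroup G g K \<subseteq> conj_subgroup G g L"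
  by (auto simp: conj_subgroup_def l_coset_def r_coset_def)

lemma conj_subgroup_inv:
  assumes "K \<subseteq> carrier G" "g \<in> carrier G"
  shows "conj_subgroup G (inv g) (conj_subgroup G g K) = K"
    "conj_subgroup G g (conj_subgroup G (inv g) K) = K"
  using assms by (simp_all add: conj_subgroup_mult[symmetric] conj_subgroup_one)

lemma conj_subgroup_inv_subset_iff:
  assumes "K \<subseteq> carrier G" "L \<subseteq> carrier G" "g \<in> carrier G"
  shows "L \<subseteq> conj_subgroup G g K \<longleftrightarrow> conj_subgroup G (inv g) L \<subseteq> K"
  using conj_subgroup_mono[of L "conj_subgroup G g K" "inv g"]
    conj_subgroup_mono[of "conj_subgroup G (inv g) L" K g] assms conj_subgroup_inv by auto

text \<open>If some \<open>a\<close> conjugates \<open>H\<close> to \<open>L\<close>, then the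
  elements doing so form the left coset of the normalizer through \<open>a\<close>.\<close>

lemma card_conjugators:
  assumes H: "H \<subseteq> carrier G" and L: "L \<subseteq> carrier G"
  shows "card {g \<in> carrier G. conj_subgroup G (inv g) L = H} =
    (if \<exists>g\<in>carrier G. L = conj_subgroup G g H then card (normalizer G H) else 0)"
proof -
  have eq: "conj_subgroup G (inv g) L = H \<longleftrightarrow> L = conj_subgroup G g H" if "g \<in> carrier G" for g
    using conj_subgroup_inv(1)[OF H that] conj_subgroup_inv(2)[OF L that] by auto
  have N: "normalizer G H = {g \<in> carrier G. conj_subgroup G g H = H}"
    using H by (auto simp: normalizer_def stabilizer_def conj_subgroup_def)
  have "card {g \<in> carrier G. L = conj_subgroup G g H} = card (normalizer G H)"
    if a: "a \<in> carrier G" "L = conj_subgroup G a H" for a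
  proof -
    have "bij_betw (\<lambda>n. a \<otimes> n) (normalizer G H) {g \<in> carrier G. L = conj_subgroup G g H}"
    proof (rule bij_betw_byWitness[where f' = "\<lambda>g. inv a \<otimes> g"])
      show "\<forall>n\<in>normalizer G H. inv a \<otimes> (a \<otimes> n) = n"
        using a by (auto simp: N m_assoc[symmetric])
      show "\<forall>g\<in>{g \<in> carrier G. L = conj_subgroup G g H}. a \<otimes> (inv a \<otimes> g) = g"
        using a by (auto simp: m_assoc[symmetric])
      show "(\<lambda>n. a \<otimes> n) ` normalizer G H \<subseteq> {g \<in> carrier G. L = conj_subgroup G g H}"
        using a H by (auto simp: N conj_subgroup_mult)
      show "(\<lambda>g. inv a \<otimes> g) ` {g \<in> carrier G. L = conj_subgroup G g H} \<subseteq> normalizer G H"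
      proof clarify
        fix g assume g: "g \<in> carrier G" "L = conj_subgroup G g H"
        have "conj_subgroup G (inv a \<otimes> g) H = conj_subgroup G (inv a) L"
          using a g H by (simp add: conj_subgroup_mult)
        also have "\<dots> = H" using a H by (simp add: conj_subgroup_inv)
        finally show "inv a \<otimes> g \<in> normalizer G H" using a g by (simp add: N)
      qed
    qed
    then show ?thesis by (simp add: bij_betw_same_card)
  qed
  then show ?thesis using eq by (auto cong: conj_cong)
qed

text \<open>The computation stays in the integers, with each product of \<open>card K\<close> and a
  mark written as a sum of indicators over the group. Swapping the sums leaves one Moebius sum for
  each \<open>g\<close>; division by the order of the normalizer comes last.\<close>

lemma sum_mobius_fixed_points:
  assumes H: "H \<in> adm" and L: "L \<in> adm"
  shows "(\<Sum>K | (K, H) \<in> \<O>. rat_of_nat (card K) / rat_of_nat (card (normalizer G H)) *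
      rat_of_int (transfer_mobius \<O> K H) * rat_of_nat (card (fixed_points (coset_gset G K) L))) =
    (if \<exists>g\<in>carrier G. L = conj_subgroup G g H then 1 else 0)"
proof -
  let ?N = "card (normalizer G H)" and ?B = "{K. (K, H) \<in> \<O>}"
  have finB: "finite ?B"
    by (rule finite_subset[of _ "Pow (carrier G)"])
      (auto simp: finite_carrier dest: transfer_subgroup subgroup.subset)
  have mark: "int (card K * card (fixed_points (coset_gset G K) L)) =
      (\<Sum>g\<in>carrier G. if conj_subgroup G (inv g) L \<subseteq> K then 1 else 0)" if "K \<in> ?B" for K
  proof -
    have K: "subgroup K G" using that transfer_subgroup by blast
    have "card K * card (fixed_points (coset_gset G K) L) =
        card {g \<in> carrier G. L \<subseteq> conj_subgroup G g K}"
      by (rule card_fixed_points_coset[OF is_group K finite_carrier admD(2)[OF L]])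
    also have "{g \<in> carrier G. L \<subseteq> conj_subgroup G g K} =
        {g \<in> carrier G. conj_subgroup G (inv g) L \<subseteq> K}"
      using conj_subgroup_inv_subset_iff[OF subgroup.subset[OF K] admD(2)[OF L]] by auto
    finally show ?thesis
      using finite_carrier by (simp add: sum.If_cases Int_def)
  qed
  have inner: "(\<Sum>K\<in>?B. if conj_subgroup G (inv g) L \<subseteq> K then transfer_mobius \<O> K H else 0) =
      (if conj_subgroup G (inv g) L = H then 1 else 0)" if g: "g \<in> carrier G" for g
  proof -
    let ?M = "conj_subgroup G (inv g) L"
    have M: "?M \<in> adm" using adm_conj[OF L] g by simp
    have "(\<Sum>K\<in>?B. if ?M \<subseteq> K then transfer_mobius \<O> K H else 0) =
        (\<Sum>K | (?M, K) \<in> \<O> \<and> (K, H) \<in> \<O>. transfer_mobius \<O> K H)"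
    proof -
      have "{K \<in> ?B. ?M \<subseteq> K} = {K. (?M, K) \<in> \<O> \<and> (K, H) \<in> \<O>}"
        using adm_transfer[OF M] transfer_subset transfer_subgroup by blast
      then show ?thesis using finB by (simp add: sum.inter_filter[symmetric])
    qed
    also have "\<dots> = (if ?M = H then 1 else 0)"
    \<comment> \<open>A conjugate without a transfer to \<open>H\<close> gives an empty sum, and it
      differs from \<open>H\<close> because transfers are reflexive.\<close>
    proof (cases "(?M, H) \<in> \<O>")
      case True
      then show ?thesis by (rule sum_mobius)
    next
      case False
      then have "{K. (?M, K) \<in> \<O> \<and> (K, H) \<in> \<O>} = {}" using transfer_trans by blast
      moreover have "?M \<noteq> H" using False transfer_refl[OF admD(1)[OF H]] by auto
      ultimately show ?thesis by (simp only: sum.empty if_False)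
    qed
    finally show ?thesis .
  qed
  have "(\<Sum>K\<in>?B. transfer_mobius \<O> K H * int (card K * card (fixed_points (coset_gset G K) L))) =
      (\<Sum>K\<in>?B. \<Sum>g\<in>carrier G. if conj_subgroup G (inv g) L \<subseteq> K then transfer_mobius \<O> K H else 0)"
    by (intro sum.cong refl, subst mark)
      (auto simp: sum_distrib_left if_distrib cong: if_cong simp del: of_nat_mult)
  also have "\<dots> = (\<Sum>g\<in>carrier G. \<Sum>K\<in>?B. if conj_subgroup G (inv g) L \<subseteq> K then transfer_mobius \<O> K H else 0)"
    by (rule sum.swap)
  also have "\<dots> = (\<Sum>g\<in>carrier G. if conj_subgroup G (inv g) L = H then 1 else 0)"
    by (intro sum.cong refl inner)
  also have "\<dots> = int (card {g \<in> carrier G. conj_subgroup G (inv g) L = H})"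
    using finite_carrier by (simp add: sum.If_cases Int_def)
  also have "card {g \<in> carrier G. conj_subgroup G (inv g) L = H} =
      (if \<exists>g\<in>carrier G. L = conj_subgroup G g H then ?N else 0)"
    by (rule card_conjugators[OF admD(2)[OF H] admD(2)[OF L]])
  finally have int_sum:
    "(\<Sum>K\<in>?B. transfer_mobius \<O> K H * int (card K * card (fixed_points (coset_gset G K) L))) =
      int (if \<exists>g\<in>carrier G. L = conj_subgroup G g H then ?N else 0)" .
  \<comment> \<open>Division by zero would give 0, so the value 1 on conjugates of \<open>H\<close>
    depends on this.\<close>
  have "?N > 0"
  proof -
    have "\<one> \<in> normalizer G H"
      using conj_subgroup_one[OF admD(2)[OF H]] admD(2)[OF H]
      by (simp add: normalizer_def stabilizer_def conj_subgroup_def)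
    moreover have "finite (normalizer G H)"
      using finite_carrier by (simp add: normalizer_def stabilizer_def)
    ultimately show ?thesis by (auto simp: card_gt_0_iff)
  qed
  moreover have "(\<Sum>K\<in>?B. rat_of_nat (card K) / rat_of_nat ?N *
      rat_of_int (transfer_mobius \<O> K H) * rat_of_nat (card (fixed_points (coset_gset G K) L))) =
    of_int (\<Sum>K\<in>?B. transfer_mobius \<O> K H * int (card K * card (fixed_points (coset_gset G K) L))) / of_nat ?N"
    by (simp add: sum_divide_distrib mult_ac)
  ultimately show ?thesis unfolding int_sum by simp
qed

section \<open>The Burnside ring as a separated structure\<close>

sublocale marks: separated_monoid "gset_semiring G \<O>" adm class_mark
  by (rule separated_gset_semiring)

sublocale groth_marks: separated_group "grothendieck_ring (gset_semiring G \<O>)" adm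
    "\<lambda>K. groth_extend (class_mark K)"
  by (intro separated_group.intro marks.separated_grothendieck marks.abelian_group_grothendieck)

sublocale burnside: separated_monoid "burnside_ring G \<O>" adm
    "\<lambda>K. rat_extend (groth_extend (class_mark K))"
  unfolding burnside_ring_def by (rule groth_marks.separated_rationalization)

lemma coset_class_closed:
  "K \<in> adm \<Longrightarrow> gset_class G (coset_gset G K) \<in> carrier (gset_semiring G \<O>)"
  by (rule gset_class_closed[OF finite_coset_gset[OF is_group admD(1) finite_carrier] admissible_coset_gset])

lemma burnside_elem_coset:
  assumes "K \<in> adm"
  shows "burnside_elem G \<O> (coset_gset G K) \<in> carrier (burnside_ring G \<O>)"
    and "L \<in> adm \<Longrightarrow> rat_extend (groth_extend (class_mark L)) (burnside_elem G \<O> (coset_gset G K)) =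
      of_nat (card (fixed_points (coset_gset G K) L))"
  using coset_class_closed[OF assms]
  by (simp_all add: burnside_elem_def burnside_ring_def groth_marks.rat_of_elem_closed
      groth_marks.rat_extend_rat_of_elem marks.groth_of_closed marks.groth_extend_groth_of
      class_mark_gset_class[OF finite_coset_gset[OF is_group admD(1)[OF assms] finite_carrier]] admD(2))

text \<open>Separation read as injectivity; it guarantees that \<open>the_inv_into\<close> in
  \<open>burnside_idempotent\<close> recovers an element from its marks.\<close>

lemma inj_on_burnside_marks: "inj_on (burnside_marks G \<O>) (carrier (burnside_ring G \<O>))"
proof (rule inj_onI)
  fix x y assume xy: "x \<in> carrier (burnside_ring G \<O>)" "y \<in> carrier (burnside_ring G \<O>)"
    and eq: "burnside_marks G \<O> x = burnside_marks G \<O> y"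
  show "x = y"
  proof (rule burnside.separated[OF xy])
    fix K assume "K \<in> adm"
    then show "rat_extend (groth_extend (class_mark K)) x = rat_extend (groth_extend (class_mark K)) y"
      using fun_cong[OF eq, of K] by (simp add: burnside_marks_def)
  qed
qed

end

theorem lemma3p12:
  fixes G :: "('a, 'm) monoid_scheme" and \<O> :: "('a set \<times> 'a set) set" and H :: "'a set"
  assumes "group G" and "finite (carrier G)"
    and "transfer_system G \<O>"
    and "H \<in> admissible_subgroups G \<O>"
  shows "burnside_idempotent G \<O> H =
    (\<Oplus>\<^bsub>burnside_ring G \<O>\<^esub> K \<in> {K. (K, H) \<in> \<O>}.
       (rat_of_nat (card K) / rat_of_nat (card (normalizer G H)) * rat_of_int (transfer_mobius \<O> K H))
         \<odot>\<^bsub>burnside_ring G \<O>\<^esub> burnside_elem G \<O> (coset_gset G K))"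
proof -
  interpret group G by fact
  interpret transfer_group G \<O>
    by unfold_locales (use assms in auto)
  let ?t = "\<lambda>K. (rat_of_nat (card K) / rat_of_nat (card (normalizer G H)) * rat_of_int (transfer_mobius \<O> K H))
         \<odot>\<^bsub>burnside_ring G \<O>\<^esub> burnside_elem G \<O> (coset_gset G K)"
  have K: "K \<in> adm" if "(K, H) \<in> \<O>" for K
    using transfer_adm[OF that assms(4)] .
  \<comment> \<open>Over an infinite index set \<open>finsum\<close> would take its default value
    zero; finiteness lets the marks be summed term by term.\<close>
  have fin: "finite {K. (K, H) \<in> \<O>}"
    by (rule finite_subset[OF _ finite_adm]) (use K in blast)
  have t: "?t \<in> {K. (K, H) \<in> \<O>} \<rightarrow> carrier (burnside_ring G \<O>)"
    using burnside_elem_coset(1)[OF K] groth_marks.smult_closed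
    by (auto simp: burnside_ring_def)
  have "burnside_marks G \<O> (finsum (burnside_ring G \<O>) ?t {K. (K, H) \<in> \<O>}) = class_indicator G \<O> H"
    unfolding burnside_marks_def class_indicator_def
  proof (rule restrict_ext)
    fix L assume L: "L \<in> adm"
    have "rat_extend (groth_extend (class_mark L)) (?t K) =
        rat_of_nat (card K) / rat_of_nat (card (normalizer G H)) * rat_of_int (transfer_mobius \<O> K H) *
        rat_of_nat (card (fixed_points (coset_gset G K) L))" if "(K, H) \<in> \<O>" for K
      using groth_marks.rat_extend_smult[OF L] burnside_elem_coset[OF K[OF that]] L
      by (simp add: burnside_ring_def)
    then show "rat_extend (groth_extend (class_mark L)) (finsum (burnside_ring G \<O>) ?t {K. (K, H) \<in> \<O>}) =
        (if \<exists>g\<in>carrier G. L = conj_subgroup G g H then 1 else 0)"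
      unfolding burnside.f_finsum[OF L fin t] sum_mobius_fixed_points[OF assms(4) L, symmetric]
      by (intro sum.cong) auto
  qed
  moreover have "finsum (burnside_ring G \<O>) ?t {K. (K, H) \<in> \<O>} \<in> carrier (burnside_ring G \<O>)"
    using t by (rule burnside.finsum_closed)
  \<comment> \<open>The sum has the indicator as its marks and lies in the carrier, so by
    injectivity it is the inverse image defining the idempotent.\<close>
  ultimately show ?thesis
    unfolding burnside_idempotent_def by (intro the_inv_into_f_eq inj_on_burnside_marks)
qed

end
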